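(* Arrange all Baxter slicings in a rooted tree as follows: the root is the unique Baxter slicing of size $1$ (a single cell), and the children of a Baxter slicing $B$ of size $n$ are the Baxter slicings of size $n+1$ obtained from $B$ either by adding on top of $B$ a new topmost row, right-aligned with the right side of the bounding rectangle of $B$, of width $i$ with $1\le i\le h$, which becomes a new horizontal block, or by adding to the right of $B$ a new rightmost column, top-aligned with the top of the bounding rectangle of $B$, of height $j$ with $1\le j\le k$, which becomes a new vertical block. Here $h$ is the width of the topmost row of $B$ and $k$ is the height of the rightmost column of $B$. Label each Baxter slicing by $(h,k)$. Then this tree has root label $(1,1)$, and the children of a slicing with label $(h,k)$ have exactly the labels $(1,k+1),(2,k+1),\ldots,(h,k+1),(h+1,1),(h+1,2),\ldots,(h+1,k)$. In other words, Baxter slicings grow according to the succession rule (Bax). Consequently, for every $n\ge1$, the number of Baxter slicings of size $n$ is the Baxter number $B_n=\sum_{k=1}^{n}\binom{n+1}{k-1}\binom{n+1}{k}\binom{n+1}{k+1}\Big/\left(\binom{n+1}{1}\binom{n+1}{2}\right)$.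
   Context: A parallelogram polyomino is an edge-connected set of unit cells of the plane forming the interior of a contour made of two lattice paths with unit steps $(0,1)$ and $(1,0)$. The two paths meet only at their common start and at their common end. If the minimal bounding rectangle has dimensions $(k,\ell)$, the size is $k+\ell-1$. A Baxter slicing of size $n$ is a parallelogram polyomino $P$ of size $n$ whose interior is divided into $n$ blocks, defined recursively: - for $n=1$, the single cell is the single block; - for $n\ge2$, one block is either the topmost row of $P$ (a horizontal block) or the rightmost column of $P$ (a vertical block), and the remaining $n-1$ blocks form a Baxter slicing of the parallelogram polyomino of size $n-1$ obtained by deleting that row, respectively that column. A succession rule gives a root label and, for each label, a list of labels of its children. It determines a rooted labelled tree whose root is at depth $1$. *)

theory Defs
  imports Complex_Main "HOL-Library.Multiset"
begin

section \<open>Parallelogram polyominoes\<close>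

text \<open>
  The cell \<open>(x, y)\<close> is the unit square with corners \<open>(x, y)\<close> and \<open>(x + 1, y + 1)\<close>.
  Polyominoes are taken up to translation; the representative of a parallelogram polyomino is
  the one whose two boundary paths start at the origin. Adding or deleting a topmost row or a
  rightmost column leaves the starting point unchanged.
\<close>

type_synonym cell = "nat \<times> nat"

datatype step = North | East

fun path_points :: "nat \<times> nat \<Rightarrow> step list \<Rightarrow> (nat \<times> nat) list" where
  "path_points p [] = [p]"
| "path_points (x, y) (North # w) = (x, y) # path_points (x, Suc y) w"
| "path_points (x, y) (East # w) = (x, y) # path_points (Suc x, y) w"

text \<open>
  \<open>U\<close> is the upper path and \<open>L\<close> the lower one. As the two paths separate at once, \<open>U\<close> starts with
  a north step and \<open>L\<close> with an east step; this also rules out two coinciding paths of length 1,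
  which share no lattice point but their ends.
\<close>

definition contour :: "step list \<Rightarrow> step list \<Rightarrow> bool" where
  "contour U L \<longleftrightarrow>
     U \<noteq> [] \<and> L \<noteq> [] \<and> hd U = North \<and> hd L = East \<and>
     last (path_points (0, 0) U) = last (path_points (0, 0) L) \<and>
     set (path_points (0, 0) U) \<inter> set (path_points (0, 0) L) =
       {(0, 0), last (path_points (0, 0) U)}"

text \<open>
  A path uses the horizontal unit edge from \<open>(x, y)\<close> to \<open>(x + 1, y)\<close> iff it visits both of its
  ends. A cell is inside the contour iff, in its column, the edge of \<open>L\<close> is below it and the edge
  of \<open>U\<close> is above it.
\<close>

definition contour_interior :: "step list \<Rightarrow> step list \<Rightarrow> cell set" where
  "contour_interior U L = {(x, y).
     (\<exists>b\<le>y. {(x, b), (Suc x, b)} \<subseteq> set (path_points (0, 0) L)) \<and>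
     (\<exists>t>y. {(x, t), (Suc x, t)} \<subseteq> set (path_points (0, 0) U))}"

fun share_edge :: "cell \<Rightarrow> cell \<Rightarrow> bool" where
  "share_edge (x, y) (x', y') \<longleftrightarrow>
     x = x' \<and> (y = Suc y' \<or> y' = Suc y) \<or> y = y' \<and> (x = Suc x' \<or> x' = Suc x)"

definition edge_connected :: "cell set \<Rightarrow> bool" where
  "edge_connected P \<longleftrightarrow>
     (\<forall>c\<in>P. \<forall>d\<in>P. (c, d) \<in> {(a, b). a \<in> P \<and> b \<in> P \<and> share_edge a b}\<^sup>*)"

definition parallelogram_polyomino :: "cell set \<Rightarrow> bool" where
  "parallelogram_polyomino P \<longleftrightarrow>
     edge_connected P \<and> (\<exists>U L. contour U L \<and> P = contour_interior U L)"

text \<open>The abscissa of the right side and the ordinate of the top side of the bounding rectangle.\<close>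

definition right_side :: "cell set \<Rightarrow> nat" where
  "right_side P = Suc (Max (fst ` P))"

definition top_side :: "cell set \<Rightarrow> nat" where
  "top_side P = Suc (Max (snd ` P))"

definition box_width :: "cell set \<Rightarrow> nat" where
  "box_width P = right_side P - Min (fst ` P)"

definition box_height :: "cell set \<Rightarrow> nat" where
  "box_height P = top_side P - Min (snd ` P)"

definition polyomino_size :: "cell set \<Rightarrow> nat" where
  "polyomino_size P = box_width P + box_height P - 1"

definition top_row :: "cell set \<Rightarrow> cell set" where
  "top_row P = {c \<in> P. snd c = Max (snd ` P)}"

definition right_column :: "cell set \<Rightarrow> cell set" where
  "right_column P = {c \<in> P. fst c = Max (fst ` P)}"

section \<open>Baxter slicings\<close>

text \<open>
  A slicing is a polyomino together with the set of its blocks, each block being a set of cells.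
\<close>

type_synonym slicing = "cell set \<times> cell set set"

inductive baxter_slicing :: "nat \<Rightarrow> cell set \<Rightarrow> cell set set \<Rightarrow> bool" where
  single: "\<lbrakk>parallelogram_polyomino P; polyomino_size P = 1\<rbrakk> \<Longrightarrow> baxter_slicing 1 P {P}"
| horizontal: "\<lbrakk>parallelogram_polyomino P; polyomino_size P = Suc n;
     baxter_slicing n (P - top_row P) S\<rbrakk> \<Longrightarrow> baxter_slicing (Suc n) P (insert (top_row P) S)"
| vertical: "\<lbrakk>parallelogram_polyomino P; polyomino_size P = Suc n;
     baxter_slicing n (P - right_column P) S\<rbrakk> \<Longrightarrow>
     baxter_slicing (Suc n) P (insert (right_column P) S)"

definition baxter_slicings :: "nat \<Rightarrow> slicing set" where
  "baxter_slicings n = {(P, S). baxter_slicing n P S}"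

fun slicing_label :: "slicing \<Rightarrow> nat \<times> nat" where
  "slicing_label (P, S) = (card (top_row P), card (right_column P))"

definition new_row :: "cell set \<Rightarrow> nat \<Rightarrow> cell set" where
  "new_row P i = {right_side P - i..<right_side P} \<times> {top_side P}"

definition new_column :: "cell set \<Rightarrow> nat \<Rightarrow> cell set" where
  "new_column P j = {right_side P} \<times> {top_side P - j..<top_side P}"

fun add_row :: "slicing \<Rightarrow> nat \<Rightarrow> slicing" where
  "add_row (P, S) i = (P \<union> new_row P i, insert (new_row P i) S)"

fun add_column :: "slicing \<Rightarrow> nat \<Rightarrow> slicing" where
  "add_column (P, S) j = (P \<union> new_column P j, insert (new_column P j) S)"

section \<open>Labelled rooted trees and succession rules\<close>

record ('v, 'l) labelled_tree =
  verts :: "'v set"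
  root_vertex :: 'v
  arcs :: "('v \<times> 'v) set"  \<comment> \<open>pairs (parent, child)\<close>
  lab :: "'v \<Rightarrow> 'l"

definition rooted_tree :: "('v, 'l) labelled_tree \<Rightarrow> bool" where
  "rooted_tree T \<longleftrightarrow>
     root_vertex T \<in> verts T \<and> arcs T \<subseteq> verts T \<times> verts T \<and>
     (\<forall>u. (u, root_vertex T) \<notin> arcs T) \<and>
     (\<forall>v \<in> verts T - {root_vertex T}. \<exists>!u. (u, v) \<in> arcs T) \<and>
     (\<forall>v \<in> verts T. (root_vertex T, v) \<in> (arcs T)\<^sup>*)"

definition children :: "('v, 'l) labelled_tree \<Rightarrow> 'v \<Rightarrow> 'v set" where
  "children T v = {w. (v, w) \<in> arcs T}"

definition isomorphic_trees :: "('v, 'l) labelled_tree \<Rightarrow> ('w, 'l) labelled_tree \<Rightarrow> bool" where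
  "isomorphic_trees T T' \<longleftrightarrow>
     (\<exists>\<phi>. bij_betw \<phi> (verts T) (verts T') \<and> \<phi> (root_vertex T) = root_vertex T' \<and>
        (\<forall>u\<in>verts T. \<forall>v\<in>verts T. (u, v) \<in> arcs T \<longleftrightarrow> (\<phi> u, \<phi> v) \<in> arcs T') \<and>
        (\<forall>v\<in>verts T. lab T' (\<phi> v) = lab T v))"

record 'l succession_rule =
  root_label :: 'l
  child_labels :: "'l \<Rightarrow> 'l list"

text \<open>
  In the tree determined by a rule, a vertex is the list of the child indices chosen on the way
  from the root to it, the last choice coming first. The root is the empty list.
\<close>

primrec node_label :: "'l succession_rule \<Rightarrow> nat list \<Rightarrow> 'l" where
  "node_label R [] = root_label R"
| "node_label R (i # w) = child_labels R (node_label R w) ! i"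

inductive_set rule_nodes :: "'l succession_rule \<Rightarrow> nat list set" for R where
  "[] \<in> rule_nodes R"
| "\<lbrakk>w \<in> rule_nodes R; i < length (child_labels R (node_label R w))\<rbrakk> \<Longrightarrow> i # w \<in> rule_nodes R"

definition rule_tree :: "'l succession_rule \<Rightarrow> (nat list, 'l) labelled_tree" where
  "rule_tree R = \<lparr>verts = rule_nodes R, root_vertex = [],
     arcs = {(w, i # w) | w i. i # w \<in> rule_nodes R}, lab = node_label R\<rparr>"

definition grows_according_to :: "('v, 'l) labelled_tree \<Rightarrow> 'l succession_rule \<Rightarrow> bool" where
  "grows_according_to T R \<longleftrightarrow> rooted_tree T \<and> isomorphic_trees T (rule_tree R)"

definition Bax :: "(nat \<times> nat) succession_rule" where
  "Bax = \<lparr>root_label = (1, 1),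
     child_labels = (\<lambda>(h, k).
       map (\<lambda>i. (i, k + 1)) [1..<h + 1] @ map (\<lambda>j. (h + 1, j)) [1..<k + 1])\<rparr>"

section \<open>The tree of Baxter slicings and Baxter numbers\<close>

definition baxter_arc :: "slicing \<Rightarrow> slicing \<Rightarrow> bool" where
  "baxter_arc B C \<longleftrightarrow>
     (\<exists>n\<ge>1. B \<in> baxter_slicings n \<and> C \<in> baxter_slicings (n + 1)) \<and>
     ((\<exists>i. 1 \<le> i \<and> i \<le> fst (slicing_label B) \<and> C = add_row B i) \<or>
      (\<exists>j. 1 \<le> j \<and> j \<le> snd (slicing_label B) \<and> C = add_column B j))"

definition baxter_tree :: "(slicing, nat \<times> nat) labelled_tree" where
  "baxter_tree = \<lparr>verts = (\<Union>n\<in>{1..}. baxter_slicings n), root_vertex = ({(0, 0)}, {{(0, 0)}}),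
     arcs = {(B, C). baxter_arc B C}, lab = slicing_label\<rparr>"

definition baxter_number :: "nat \<Rightarrow> real" where
  "baxter_number n =
     (\<Sum>k = 1..n. real ((n + 1) choose (k - 1)) * real ((n + 1) choose k) * real ((n + 1) choose (k + 1))
        / (real ((n + 1) choose 1) * real ((n + 1) choose 2)))"

end

theory Submission
  imports Defs
begin

text \<open>
  Reading off the heights of the horizontal steps of the two contour paths turns a parallelogram
  polyomino into a row of columns whose bottoms and tops are nondecreasing, consecutive columns
  sharing an edge. In this form a topmost row is always right-aligned and a rightmost column
  top-aligned, so adding and deleting them are inverse to each other. The parent of a slicing is
  unique: if the last block is the top row, the rightmost column meets at least two blocks and
  hence is not a block itself.

  For the enumeration, the number of slicings with label \<open>(i, j)\<close> obtained from the unit cell by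
  \<open>p\<close> row additions and \<open>q\<close> column additions has a closed product form. The recurrence dictated by
  the rule is checked with the closed form of \<open>\<Sum>a\<ge>i. a * binomial (L - a) m\<close>: all its terms then
  have the same upper binomial indices, and it becomes a polynomial identity.
\<close>

section \<open>Parallelogram polyominoes by columns\<close>

text \<open>No set of slicings with prescribed \<open>p\<close>, \<open>q\<close> and label is ever
  formed. Closed form and slicings are compared through sums of an arbitrary real function of the
  label over one level: passing to the next level replaces the function by its sum over the
  children, and the closed form obeys the transposed rule. The constant function 1 then counts.

  Keeping \<open>p\<close> and \<open>q\<close> apart pays off at the end: for fixed
  \<open>p\<close> and \<open>q\<close> the sum over all labels is a single summand of the Baxter
  number, so no sum over \<open>p\<close> has to be evaluated.

  On the geometric side the delicate direction is deletion. Removing the top row can also destroy a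
  column that consists of one cell, and removing the right column can lower the top side. The size
  condition in the definition of a slicing excludes exactly this.\<close>

fun east_heights :: "nat \<Rightarrow> step list \<Rightarrow> nat list" where
  "east_heights y [] = []"
| "east_heights y (North # w) = east_heights (Suc y) w"
| "east_heights y (East # w) = y # east_heights y w"

definition end_height :: "nat \<Rightarrow> step list \<Rightarrow> nat" where
  "end_height y w = y + count_list w North"

text \<open>The list is framed by the starting and the end height so that its entries
  \<open>k\<close> and \<open>k + 1\<close> bound the vertical run at the \<open>k\<close>-th
  abscissa, the first and the last one included.\<close>

lemma sorted_east_heights: "sorted (y # east_heights y w @ [end_height y w])"
proof (induction y w rule: east_heights.induct)
  case (2 y w)
  then show ?case by (auto simp: end_height_def)
qed (auto simp: end_height_def)

lemma last_path_points:
  "last (path_points (x, y) w) = (x + length (east_heights y w), end_height y w)"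
proof (induction y w arbitrary: x rule: east_heights.induct)
  case (2 y w)
  moreover have "path_points (x, Suc y) w \<noteq> []" by (cases w rule: list.exhaust; cases "hd w") auto
  ultimately show ?case by (simp add: end_height_def)
next
  case (3 y w)
  moreover have "path_points (Suc x, y) w \<noteq> []" by (cases w rule: list.exhaust; cases "hd w") auto
  ultimately show ?case by (simp add: end_height_def)
qed (simp add: end_height_def)

text \<open>On each vertical line the path occupies one interval, from the east step that enters the
  line to the east step that leaves it. The starting and the end height replace the missing step at
  either end.\<close>

lemma mem_path_points_iff:
  "(x, y) \<in> set (path_points (x0, y0) w) \<longleftrightarrow>
     x0 \<le> x \<and> x - x0 \<le> length (east_heights y0 w) \<and>
     (y0 # east_heights y0 w) ! (x - x0) \<le> y \<and>
     y \<le> (east_heights y0 w @ [end_height y0 w]) ! (x - x0)"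
proof (induction y0 w arbitrary: x0 rule: east_heights.induct)
  case (1 y0)
  then show ?case by (auto simp: end_height_def)
next
  case (2 y0 w)
  have e: "end_height y0 (North # w) = end_height (Suc y0) w" by (simp add: end_height_def)
  \<comment> \<open>For \<open>x = x0\<close> the interval grows downwards by the point
    \<open>y0\<close>, which must lie below the upper bound.\<close>
  have "Suc y0 \<le> (east_heights (Suc y0) w @ [end_height (Suc y0) w]) ! 0"
    using sorted_east_heights[of "Suc y0" w] by (auto simp: nth_append)
  then show ?case
    unfolding path_points.simps east_heights.simps e set_simps insert_iff 2
    by (cases "x - x0") (auto simp: nth_Cons')
next
  case (3 y0 w)
  have e: "end_height y0 (East # w) = end_height y0 w" by (simp add: end_height_def)
  show ?case
  proof (cases "x0 < x")
    case True
    then have "x - x0 = Suc (x - Suc x0)" by simp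
    with True show ?thesis
      unfolding path_points.simps east_heights.simps e set_simps insert_iff 3 by auto
  next
    case False
    then show ?thesis
      unfolding path_points.simps east_heights.simps e set_simps insert_iff 3 by auto
  qed
qed

lemma sorted_Cons_snoc_nth:
  assumes "sorted (a # xs @ [z])" "k \<le> length xs"
  shows "(a # xs) ! k \<le> (xs @ [z]) ! k"
proof -
  have "(a # xs @ [z]) ! k \<le> (a # xs @ [z]) ! Suc k"
    using assms by (intro sorted_nth_mono) auto
  moreover have "(a # xs @ [z]) ! k = (a # xs) ! k"
    using assms(2) by (cases k) (auto simp: nth_append)
  ultimately show ?thesis by simp
qed

text \<open>The intervals occupied on two neighbouring vertical lines share only the height of the
  east step between them.\<close>

lemma path_edge_iff:
  "{(x, b), (Suc x, b)} \<subseteq> set (path_points (0, 0) w) \<longleftrightarrow>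
     x < length (east_heights 0 w) \<and> b = east_heights 0 w ! x"
proof -
  let ?h = "east_heights 0 w"
  have "(0 # ?h) ! x \<le> ?h ! x \<and> ?h ! x \<le> (?h @ [end_height 0 w]) ! Suc x" if "x < length ?h"
    using sorted_Cons_snoc_nth[OF sorted_east_heights[of 0 w], of x]
      sorted_Cons_snoc_nth[OF sorted_east_heights[of 0 w], of "Suc x"] that
    by (auto simp: nth_append)
  then show ?thesis
    by (auto simp: mem_path_points_iff nth_append)
qed

text \<open>A right inverse of \<open>east_heights\<close> with prescribed end height
  \<open>z\<close>, used to draw the contour of a given row of columns. On sorted heights the
  truncated differences are exact.\<close>

primrec path_of_heights :: "nat \<Rightarrow> nat list \<Rightarrow> nat \<Rightarrow> step list" where
  "path_of_heights y [] z = replicate (z - y) North"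
| "path_of_heights y (h # hs) z = replicate (h - y) North @ East # path_of_heights h hs z"

lemma east_heights_replicate_North:
  "east_heights y (replicate k North @ w) = east_heights (y + k) w"
  by (induction k arbitrary: y) auto

lemma east_heights_path_of_heights:
  "sorted (y # hs @ [z]) \<Longrightarrow> east_heights y (path_of_heights y hs z) = hs"
proof (induction hs arbitrary: y)
  case Nil
  then show ?case using east_heights_replicate_North[of y "z - y" "[]"] by simp
qed (auto simp: east_heights_replicate_North)

lemma end_height_path_of_heights:
  "sorted (y # hs @ [z]) \<Longrightarrow> end_height y (path_of_heights y hs z) = z"
proof -
  have r: "count_list (replicate k North) North = k" for k by (induction k) auto
  show "sorted (y # hs @ [z]) \<Longrightarrow> end_height y (path_of_heights y hs z) = z"
    by (induction hs arbitrary: y) (auto simp: end_height_def r)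
qed

section \<open>Rows of columns and their contours\<close>

definition columns :: "nat \<Rightarrow> (nat \<Rightarrow> nat) \<Rightarrow> (nat \<Rightarrow> nat) \<Rightarrow> cell set" where
  "columns W b t = {(x, y). x < W \<and> b x \<le> y \<and> y < t x}"

text \<open>\<open>b 0 = 0\<close> fixes the translation. \<open>b (Suc x) < t x\<close> lets
  neighbouring columns share an edge; for the contour it says that the two paths do not touch on the
  line between them.\<close>

definition column_shape :: "nat \<Rightarrow> (nat \<Rightarrow> nat) \<Rightarrow> (nat \<Rightarrow> nat) \<Rightarrow> bool" where
  "column_shape W b t \<longleftrightarrow> W > 0 \<and> b 0 = 0 \<and> (\<forall>x<W. b x < t x) \<and>
     (\<forall>x. Suc x < W \<longrightarrow> b x \<le> b (Suc x) \<and> t x \<le> t (Suc x) \<and> b (Suc x) < t x)"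

lemma column_shape_mono:
  assumes "column_shape W b t" "x \<le> x'" "x' < W"
  shows "b x \<le> b x' \<and> t x \<le> t x'"
  using assms(2,3)
proof (induction x' rule: dec_induct)
  case (step m)
  then show ?case using assms(1) unfolding column_shape_def
    by (meson Suc_lessD order_trans)
qed simp

text \<open>On every vertical line strictly between the ends the two paths occupy disjoint
  intervals. The first steps put \<open>U\<close> above \<open>L\<close>, and this order is passed
  on from line to line.\<close>

lemma contour_imp_column_shape:
  assumes "contour U L"
  shows "\<exists>W b t. column_shape W b t \<and> contour_interior U L = columns W b t"
proof (intro exI conjI)
  let ?u = "east_heights 0 U" and ?l = "east_heights 0 L"
  let ?W = "length ?u"
  define H where "H = end_height 0 U"
  have len: "length ?l = ?W" and H: "end_height 0 L = H"
    using assms by (auto simp: contour_def last_path_points H_def)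
  show "contour_interior U L = columns ?W (\<lambda>x. ?l ! x) (\<lambda>x. ?u ! x)"
    unfolding contour_interior_def path_edge_iff columns_def len by auto
  obtain L' where L': "L = East # L'" using assms by (cases L) (auto simp: contour_def)
  obtain U' where U': "U = North # U'" using assms by (cases U) (auto simp: contour_def)
  have W: "?W > 0" using L' len by (metis east_heights.simps(3) length_Cons zero_less_Suc)
  have l0: "?l ! 0 = 0" using L' by simp
  have u0: "?u ! 0 > 0"
    using sorted_east_heights[of 1 U'] U' W by (auto simp: Suc_le_eq)
  have ends: "set (path_points (0, 0) U) \<inter> set (path_points (0, 0) L) = {(0, 0), (?W, H)}"
    using assms by (simp add: contour_def last_path_points H_def)
  have mono: "?u ! x \<le> ?u ! Suc x" "?l ! x \<le> ?l ! Suc x" if "Suc x < ?W" for x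
    using sorted_Cons_snoc_nth[OF sorted_east_heights[of 0 U], of "Suc x"]
      sorted_Cons_snoc_nth[OF sorted_east_heights[of 0 L], of "Suc x"] that len
    by (auto simp: nth_append)
  have sep: "?u ! Suc x < ?l ! x \<or> ?l ! Suc x < ?u ! x" if x: "Suc x < ?W" for x
  proof (rule ccontr)
    assume *: "\<not> ?thesis"
    \<comment> \<open>Two intervals neither of which lies strictly above the other overlap, and the
      larger lower end is a common point.\<close>
    have "(Suc x, max (?u ! x) (?l ! x)) \<in> set (path_points (0, 0) U) \<inter> set (path_points (0, 0) L)"
      using * x mono[OF x] len by (auto simp: mem_path_points_iff nth_append)
    then show False unfolding ends using x by auto
  qed
  have below: "?l ! x < ?u ! x" if "x < ?W" for x
    using that
  proof (induction x)
    case 0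
    then show ?case using l0 u0 by simp
  next
    case (Suc x)
    then show ?case using sep[of x] mono[of x] by auto
  qed
  show "column_shape ?W (\<lambda>x. ?l ! x) (\<lambda>x. ?u ! x)"
    unfolding column_shape_def
  proof (intro conjI allI impI)
    fix x assume x: "Suc x < ?W"
    show "?l ! Suc x < ?u ! x"
      using sep[OF x] mono[OF x] below[of x] x by auto
  qed (use W l0 below mono in auto)
qed

text \<open>Both paths end at the top right corner of the last column: \<open>U\<close> arrives
  there with its last east step, \<open>L\<close> climbs the right side.\<close>

lemma column_shape_imp_contour:
  assumes "column_shape W b t"
  shows "\<exists>U L. contour U L \<and> contour_interior U L = columns W b t"
proof -
  define H where "H = t (W - 1)"
  define u l where "u = map t [0..<W]" and "l = map b [0..<W]"
  define U L where "U = path_of_heights 0 u H" and "L = path_of_heights 0 l H"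
  have W: "W > 0" "b 0 = 0" and bt: "\<And>x. x < W \<Longrightarrow> b x < t x"
    and sep: "\<And>x. Suc x < W \<Longrightarrow> b (Suc x) < t x"
    using assms by (auto simp: column_shape_def)
  have tH: "t x \<le> H" if "x < W" for x
    using column_shape_mono[OF assms, of x "W - 1"] that by (auto simp: H_def)
  have sorted_up: "sorted (0 # map f [0..<W] @ [H])"
    if "\<And>x x'. x \<le> x' \<Longrightarrow> x' < W \<Longrightarrow> f x \<le> f x'" "\<And>x. x < W \<Longrightarrow> f x \<le> H" for f :: "nat \<Rightarrow> nat"
  proof -
    have "sorted (map f [0..<W])"
      unfolding sorted_iff_nth_mono using that(1) by auto
    then show ?thesis using that(2) by (simp add: sorted_append)
  qed
  have su: "sorted (0 # u @ [H])"
    unfolding u_def using column_shape_mono[OF assms] tH by (intro sorted_up) auto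
  have "b x \<le> H" if "x < W" for x
    using bt[OF that] tH[OF that] by simp
  then have sl: "sorted (0 # l @ [H])"
    unfolding l_def using column_shape_mono[OF assms] by (intro sorted_up) auto
  have eU: "east_heights 0 U = u" "end_height 0 U = H" and eL: "east_heights 0 L = l" "end_height 0 L = H"
    using su sl by (auto simp: U_def L_def east_heights_path_of_heights end_height_path_of_heights)
  have len: "length u = W" "length l = W" by (auto simp: u_def l_def)
  have nth: "u ! x = t x" "l ! x = b x" if "x < W" for x using that by (auto simp: u_def l_def)
  have "contour_interior U L = columns W b t"
    unfolding contour_interior_def path_edge_iff columns_def eU eL len using nth by auto
  moreover have "contour U L"
    unfolding contour_def
  proof (intro conjI)
    obtain W' where W': "W = Suc W'" using W by (cases W) auto
    have cu: "u = t 0 # map t [1..<W]" and cl: "l = b 0 # map b [1..<W]"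
      unfolding u_def l_def W' by (auto simp: upt_rec[of 0] simp del: upt_Suc)
    obtain k where k: "t 0 = Suc k" using bt[of 0] W by (cases "t 0") auto
    show "U \<noteq> []" "hd U = North" "L \<noteq> []" "hd L = East"
      unfolding U_def L_def cu cl using k W(2) by auto
    show "last (path_points (0, 0) U) = last (path_points (0, 0) L)"
      by (simp add: last_path_points eU eL len)
    have "set (path_points (0, 0) U) \<inter> set (path_points (0, 0) L) \<subseteq> {(0, 0), (W, H)}"
    proof
      fix c assume c: "c \<in> set (path_points (0, 0) U) \<inter> set (path_points (0, 0) L)"
      obtain x y where xy_eq: "c = (x, y)" by (cases c)
      have xy: "(x, y) \<in> set (path_points (0, 0) U)" "(x, y) \<in> set (path_points (0, 0) L)"
        using c xy_eq by auto
      have xW: "x \<le> W" and u: "(0 # u) ! x \<le> y" "y \<le> (u @ [H]) ! x" and l: "(0 # l) ! x \<le> y" "y \<le> (l @ [H]) ! x"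
        using xy by (auto simp: mem_path_points_iff eU eL len)
      \<comment> \<open>On the left side \<open>L\<close> stays at height \<open>b 0 = 0\<close>, on
        the right side \<open>U\<close> stays at \<open>H\<close>, and in between
        \<open>b (Suc x') < t x'\<close> keeps the paths apart.\<close>
      consider "x = 0" | x' where "x = Suc x'" "Suc x' < W" | "x = W" "x > 0"
        using xW by (cases x) force+
      then have "(x, y) = (0, 0) \<or> (x, y) = (W, H)"
      proof cases
        case 1
        then show ?thesis using l W nth[of 0] len by (simp add: nth_append)
      next
        case 2
        then show ?thesis using u l nth[of x'] nth[of "Suc x'"] len sep[of x'] by (simp add: nth_append)
      next
        case 3
        then show ?thesis using u len nth[of "W - 1"] by (auto simp: nth_append H_def nth_Cons')
      qed
      then show "c \<in> {(0, 0), (W, H)}" using xy_eq by auto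
    qed
    moreover have "{(0, 0), (W, H)} \<subseteq> set (path_points (0, 0) U) \<inter> set (path_points (0, 0) L)"
      using W len nth[of "W - 1"] bt[of "W - 1"]
      by (auto simp: mem_path_points_iff eU eL nth_append nth_Cons' H_def)
    ultimately show "set (path_points (0, 0) U) \<inter> set (path_points (0, 0) L) =
       {(0, 0), last (path_points (0, 0) U)}"
      by (simp add: last_path_points eU len)
  qed
  ultimately show ?thesis by blast
qed

text \<open>Every cell is linked to the bottom of its column, and the bottom of column
  \<open>Suc x\<close> to its left neighbour at the same height, which belongs to column
  \<open>x\<close> by \<open>b (Suc x) < t x\<close>.\<close>

lemma edge_connected_columns:
  assumes "column_shape W b t"
  shows "edge_connected (columns W b t)"
proof -
  let ?P = "columns W b t"
  let ?R = "{(c, d). c \<in> ?P \<and> d \<in> ?P \<and> share_edge c d}"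
  have down: "((x, b x), (x, y)) \<in> ?R\<^sup>*" if x: "x < W" and y: "b x \<le> y" "y < t x" for x y
    using y
  proof (induction y rule: dec_induct)
    case (step m)
    then have "((x, m), (x, Suc m)) \<in> ?R" using x by (auto simp: columns_def)
    then show ?case using step by (meson Suc_lessD rtrancl.rtrancl_into_rtrancl)
  qed simp
  have base: "((0, 0), (x, b x)) \<in> ?R\<^sup>*" if "x < W" for x
    using that
  proof (induction x)
    case 0
    then show ?case using assms by (simp add: column_shape_def)
  next
    case (Suc x)
    have s: "b x \<le> b (Suc x)" "b (Suc x) < t x" "b (Suc x) < t (Suc x)"
      using assms Suc.prems by (auto simp: column_shape_def)
    then have "((x, b (Suc x)), (Suc x, b (Suc x))) \<in> ?R"
      using Suc.prems by (auto simp: columns_def)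
    with down[of x "b (Suc x)"] s Suc show ?case
      by (meson Suc_lessD rtrancl.rtrancl_into_rtrancl rtrancl_trans)
  qed
  have from0: "((0, 0), c) \<in> ?R\<^sup>*" if "c \<in> ?P" for c
  proof (cases c)
    case (Pair x y)
    then show ?thesis using that base[of x] down[of x y] by (auto simp: columns_def)
  qed
  have "sym ?R" by (auto simp: sym_def)
  then have "(c, d) \<in> ?R\<^sup>*" if "c \<in> ?P" "d \<in> ?P" for c d
    using from0[OF that(1)] from0[OF that(2)] by (meson rtrancl_trans sym_rtrancl symD)
  then show ?thesis by (auto simp: edge_connected_def)
qed

lemma parallelogram_polyomino_iff:
  "parallelogram_polyomino P \<longleftrightarrow> (\<exists>W b t. column_shape W b t \<and> P = columns W b t)"
proof
  assume "parallelogram_polyomino P"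
  then obtain U L where "contour U L" "P = contour_interior U L"
    unfolding parallelogram_polyomino_def by blast
  with contour_imp_column_shape[of U L] show "\<exists>W b t. column_shape W b t \<and> P = columns W b t"
    by simp
next
  assume "\<exists>W b t. column_shape W b t \<and> P = columns W b t"
  then obtain W b t where shape: "column_shape W b t" and P: "P = columns W b t" by blast
  from column_shape_imp_contour[OF shape] edge_connected_columns[OF shape]
  show "parallelogram_polyomino P"
    unfolding parallelogram_polyomino_def P by metis
qed

section \<open>Bounding rectangle, top row and right column of a row of columns\<close>

lemma upward_closed_eq_atLeastLessThan:
  assumes "A \<subseteq> {..<W}" and up: "\<And>x y. x \<in> A \<Longrightarrow> x \<le> y \<Longrightarrow> y < W \<Longrightarrow> y \<in> A"
  shows "A = {W - card A..<W :: nat}"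
proof (cases "A = {}")
  case False
  have fin: "finite A" using assms(1) finite_subset by blast
  have "A = {Min A..<W}"
  proof
    show "A \<subseteq> {Min A..<W}"
      using assms(1) Min_le[OF fin] by auto
    show "{Min A..<W} \<subseteq> A"
      using up[OF Min_in[OF fin False]] by auto
  qed
  moreover have "Min A \<le> W"
    using assms(1) Min_in[OF fin False] by auto
  ultimately show ?thesis by (metis card_atLeastLessThan diff_diff_cancel)
qed simp

locale column_polyomino =
  fixes W b t P
  assumes shape: "column_shape W b t" and P_eq: "P = columns W b t"
begin

text \<open>Tops are nondecreasing, so the last column reaches the top side of the bounding
  rectangle.\<close>

definition "H = t (W - 1)"

lemma W_pos: "W > 0" and b_0: "b 0 = 0" and b_less_t: "x < W \<Longrightarrow> b x < t x"
  using shape by (auto simp: column_shape_def)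

lemma H_pos: "H > 0"
  using b_less_t[of "W - 1"] W_pos by (simp add: H_def)

lemma t_le_H: "x < W \<Longrightarrow> t x \<le> H"
  using column_shape_mono[OF shape, of x "W - 1"] by (simp add: H_def)

lemma mem_P_iff: "(x, y) \<in> P \<longleftrightarrow> x < W \<and> b x \<le> y \<and> y < t x"
  by (auto simp: P_eq columns_def)

lemma P_subset: "P \<subseteq> {..<W} \<times> {..<H}"
proof
  fix c assume c: "c \<in> P"
  obtain x y where "c = (x, y)" by (cases c)
  with c t_le_H[of x] show "c \<in> {..<W} \<times> {..<H}"
    by (simp add: mem_P_iff)
qed

lemma finite_P: "finite P"
  using P_subset finite_subset by blast

lemma corners: "(0, 0) \<in> P" "(W - 1, H - 1) \<in> P"
  using W_pos b_0 b_less_t[of 0] b_less_t[of "W - 1"] by (auto simp: mem_P_iff H_def)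

lemma Max_fst: "Max (fst ` P) = W - 1" and Max_snd: "Max (snd ` P) = H - 1"
proof -
  have "W - 1 \<in> fst ` P" "H - 1 \<in> snd ` P" using corners(2) by force+
  moreover have "x \<le> W - 1" if "x \<in> fst ` P" for x
    using that P_subset by auto
  moreover have "y \<le> H - 1" if "y \<in> snd ` P" for y
    using that P_subset by auto
  ultimately show "Max (fst ` P) = W - 1" "Max (snd ` P) = H - 1"
    using finite_P by (simp_all add: Max_eqI)
qed

lemma right_side_eq: "right_side P = W" and top_side_eq: "top_side P = H"
  using W_pos H_pos by (auto simp: right_side_def top_side_def Max_fst Max_snd)

lemma polyomino_size_eq: "polyomino_size P = W + H - 1"
proof -
  have "Min (fst ` P) = 0" "Min (snd ` P) = 0"
    using finite_P corners(1) by (auto intro!: Min_eqI) (metis fst_conv image_eqI, metis snd_conv image_eqI)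
  then show ?thesis
    by (simp add: polyomino_size_def box_width_def box_height_def right_side_eq top_side_eq)
qed

lemma top_row_eq: "top_row P = {x. x < W \<and> t x = H} \<times> {H - 1}"
proof (rule set_eqI)
  fix c :: cell
  obtain x y where c: "c = (x, y)" by (cases c)
  show "c \<in> top_row P \<longleftrightarrow> c \<in> {x. x < W \<and> t x = H} \<times> {H - 1}"
    using t_le_H[of x] b_less_t[of x] by (auto simp: c top_row_def Max_snd mem_P_iff)
qed

lemma right_column_eq: "right_column P = {W - 1} \<times> {b (W - 1)..<H}"
  using W_pos by (auto simp: right_column_def Max_fst mem_P_iff H_def)

lemma card_right_column: "card (right_column P) = H - b (W - 1)"
  by (simp add: right_column_eq)

lemma card_top_row: "card (top_row P) = card {x. x < W \<and> t x = H}"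
  by (simp only: top_row_eq card_cartesian_product) simp

text \<open>Since tops are nondecreasing, the columns that reach the top side form a final segment
  and are determined by their number. This is why a topmost row is right-aligned.\<close>

lemma full_columns: "{x. x < W \<and> t x = H} = {W - card (top_row P)..<W}"
  unfolding card_top_row
proof (rule upward_closed_eq_atLeastLessThan)
  fix x y assume "x \<in> {x. x < W \<and> t x = H}" "x \<le> y" "y < W"
  then show "y \<in> {x. x < W \<and> t x = H}"
    using column_shape_mono[OF shape, of x y] t_le_H[of y] by auto
qed auto

lemma card_top_row_pos: "card (top_row P) > 0"
proof -
  have "(W - 1, H - 1) \<in> top_row P"
    unfolding top_row_eq using W_pos by (simp add: H_def)
  moreover have "finite (top_row P)"
    using finite_P by (simp add: top_row_def)
  ultimately show ?thesis by (auto simp: card_gt_0_iff)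
qed

end

section \<open>Adding and deleting rows and columns\<close>

lemma parallelogram_polyominoE:
  assumes "parallelogram_polyomino P"
  obtains W b t where "column_polyomino W b t P"
proof -
  obtain W b t where "column_shape W b t" "P = columns W b t"
    using assms unfolding parallelogram_polyomino_iff by blast
  then have "column_polyomino W b t P" by unfold_locales
  then show thesis by (rule that)
qed

lemma (in column_polyomino) parallelogram_polyomino: "parallelogram_polyomino P"
  unfolding parallelogram_polyomino_iff using shape P_eq by blast

text \<open>By the upper bound on \<open>i\<close> the last \<open>i\<close> columns all reach the
  top side, so the new row raises each of them by one cell. The last two conclusions later show that
  the right column is not a block.\<close>

lemma add_row_polyomino:
  assumes "parallelogram_polyomino P" "1 \<le> i" "i \<le> card (top_row P)"
  defines "Q \<equiv> P \<union> new_row P i"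
  shows "parallelogram_polyomino Q" "polyomino_size Q = Suc (polyomino_size P)"
    and "top_row Q = new_row P i" "P \<inter> new_row P i = {}"
    and "card (top_row Q) = i" "card (right_column Q) = Suc (card (right_column P))"
    and "right_column Q \<inter> P \<noteq> {}" "right_column Q \<inter> new_row P i \<noteq> {}"
proof -
  obtain W b t where "column_polyomino W b t P"
    using assms(1) by (rule parallelogram_polyominoE)
  then interpret P: column_polyomino W b t P .
  define t' where "t' x = (if W - i \<le> x then Suc (t x) else t x)" for x
  have full: "t x = P.H" if "W - i \<le> x" "x < W" for x
  proof -
    have "x \<in> {W - card (top_row P)..<W}" using that assms(3) by simp
    then show ?thesis unfolding P.full_columns[symmetric] by simp
  qed
  have row: "new_row P i = {W - i..<W} \<times> {P.H}"
    by (simp add: new_row_def P.right_side_eq P.top_side_eq)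
  have "column_shape W b t'"
    unfolding column_shape_def
  proof (intro conjI allI impI)
    fix x assume x: "Suc x < W"
    have "b x \<le> b (Suc x)" "t x \<le> t (Suc x)" "b (Suc x) < t x"
      using P.shape x by (auto simp: column_shape_def)
    then show "b x \<le> b (Suc x)" "t' x \<le> t' (Suc x)" "b (Suc x) < t' x"
      by (auto simp: t'_def)
  qed (use P.W_pos P.b_0 P.b_less_t in \<open>auto simp: t'_def less_Suc_eq\<close>)
  moreover have "Q = columns W b t'"
  proof (rule set_eqI)
    fix c :: cell
    obtain x y where c: "c = (x, y)" by (cases c)
    show "c \<in> Q \<longleftrightarrow> c \<in> columns W b t'"
      using full[of x] P.b_less_t[of x]
      unfolding Q_def row by (auto simp: c columns_def P.mem_P_iff t'_def)
  qed
  ultimately have "column_polyomino W b t' Q" by unfold_locales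
  then interpret Q: column_polyomino W b t' Q .
  have QH: "Q.H = Suc P.H"
    using assms(2) P.W_pos by (simp add: Q.H_def P.H_def t'_def)
  show "parallelogram_polyomino Q" by (rule Q.parallelogram_polyomino)
  show "polyomino_size Q = Suc (polyomino_size P)"
    using P.W_pos by (simp add: P.polyomino_size_eq Q.polyomino_size_eq QH)
  have "{x. x < W \<and> t' x = Suc P.H} = {W - i..<W}"
  proof (rule set_eqI)
    fix x
    show "x \<in> {x. x < W \<and> t' x = Suc P.H} \<longleftrightarrow> x \<in> {W - i..<W}"
      using full[of x] P.t_le_H[of x] by (auto simp: t'_def)
  qed
  then show top: "top_row Q = new_row P i"
    unfolding Q.top_row_eq QH row by simp
  show "P \<inter> new_row P i = {}"
    using P.P_subset by (auto simp: row)
  \<comment> \<open>Otherwise \<open>W - i\<close> would be truncated and \<open>{W - i..<W}\<close>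
    would have fewer than \<open>i\<close> elements.\<close>
  have "i \<le> W"
  proof -
    have "card (top_row P) \<le> card {..<W}"
      unfolding P.card_top_row by (rule card_mono) auto
    then show ?thesis using assms(3) by simp
  qed
  then show "card (top_row Q) = i"
    unfolding top row by (simp add: card_cartesian_product)
  have b: "b (W - 1) < P.H" using P.b_less_t[of "W - 1"] P.W_pos by (simp add: P.H_def)
  then show "card (right_column Q) = Suc (card (right_column P))"
    by (simp add: P.card_right_column Q.card_right_column QH)
  have "(W - 1, P.H - 1) \<in> right_column Q"
    using b by (auto simp: Q.right_column_eq QH)
  then show "right_column Q \<inter> P \<noteq> {}" using P.corners by blast
  have "(W - 1, P.H) \<in> right_column Q \<inter> new_row P i"
    using b assms(2) P.W_pos by (auto simp: Q.right_column_eq QH row)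
  then show "right_column Q \<inter> new_row P i \<noteq> {}" by blast
qed

text \<open>By the upper bound on \<open>j\<close> the new column starts no lower than the last old
  one, which keeps the bottoms nondecreasing.\<close>

lemma add_column_polyomino:
  assumes "parallelogram_polyomino P" "1 \<le> j" "j \<le> card (right_column P)"
  defines "Q \<equiv> P \<union> new_column P j"
  shows "parallelogram_polyomino Q" "polyomino_size Q = Suc (polyomino_size P)"
    and "right_column Q = new_column P j" "P \<inter> new_column P j = {}"
    and "card (right_column Q) = j" "card (top_row Q) = Suc (card (top_row P))"
proof -
  obtain W b t where "column_polyomino W b t P"
    using assms(1) by (rule parallelogram_polyominoE)
  then interpret P: column_polyomino W b t P .
  define b' t' where "b' = b(W := P.H - j)" and "t' = t(W := P.H)"
  have j: "j \<le> P.H - b (W - 1)" using assms(3) by (simp add: P.card_right_column)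
  have col: "new_column P j = {W} \<times> {P.H - j..<P.H}"
    by (simp add: new_column_def P.right_side_eq P.top_side_eq)
  have b: "b (W - 1) < P.H" using P.b_less_t[of "W - 1"] P.W_pos by (simp add: P.H_def)
  have "column_shape (Suc W) b' t'"
    unfolding column_shape_def
  proof (intro conjI allI impI)
    fix x assume "Suc x < Suc W"
    then consider "Suc x < W" | "Suc x = W" by linarith
    then show "b' x \<le> b' (Suc x)" "t' x \<le> t' (Suc x)" "b' (Suc x) < t' x"
      using P.shape j b assms(2) by (cases; auto simp: column_shape_def b'_def t'_def P.H_def)+
  qed (use P.W_pos P.b_0 P.b_less_t P.H_pos assms(2) in \<open>auto simp: b'_def t'_def less_Suc_eq\<close>)
  moreover have "Q = columns (Suc W) b' t'"
  proof (rule set_eqI)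
    fix c :: cell
    obtain x y where c: "c = (x, y)" by (cases c)
    show "c \<in> Q \<longleftrightarrow> c \<in> columns (Suc W) b' t'"
      unfolding Q_def col by (auto simp: c columns_def P.mem_P_iff b'_def t'_def less_Suc_eq)
  qed
  ultimately have "column_polyomino (Suc W) b' t' Q" by unfold_locales
  then interpret Q: column_polyomino "Suc W" b' t' Q .
  have QH: "Q.H = P.H" unfolding Q.H_def by (simp add: t'_def)
  show "parallelogram_polyomino Q" by (rule Q.parallelogram_polyomino)
  show "polyomino_size Q = Suc (polyomino_size P)"
    using P.W_pos by (simp add: P.polyomino_size_eq Q.polyomino_size_eq QH)
  show right: "right_column Q = new_column P j"
    by (simp add: Q.right_column_eq QH col b'_def)
  show "P \<inter> new_column P j = {}"
    using P.P_subset by (auto simp: col)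
  show "card (right_column Q) = j"
    unfolding right col using j by simp
  have "{x. x < Suc W \<and> t' x = P.H} = insert W {x. x < W \<and> t x = P.H}"
    by (auto simp: t'_def less_Suc_eq)
  then show "card (top_row Q) = Suc (card (top_row P))"
    by (simp add: P.card_top_row Q.card_top_row QH)
qed

text \<open>The height drops by at least one and the width does not grow. As the size drops by
  exactly one, the width is unchanged, no column vanishes, and below each deleted cell there is a
  cell in the top row of the rest.\<close>

lemma delete_top_row:
  assumes "parallelogram_polyomino P" "parallelogram_polyomino (P - top_row P)"
    and size: "polyomino_size P = Suc (polyomino_size (P - top_row P))"
  obtains i where "1 \<le> i" "i \<le> card (top_row (P - top_row P))" "top_row P = new_row (P - top_row P) i"
proof -
  define Q where "Q = P - top_row P"
  obtain W b t where "column_polyomino W b t P"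
    using assms(1) by (rule parallelogram_polyominoE)
  then interpret P: column_polyomino W b t P .
  obtain W' b' t' where "column_polyomino W' b' t' Q"
    using assms(2) unfolding Q_def by (rule parallelogram_polyominoE)
  then interpret Q: column_polyomino W' b' t' Q .
  have Q_iff: "(x, y) \<in> Q \<longleftrightarrow> (x, y) \<in> P \<and> y < P.H - 1" for x y
    using P.t_le_H[of x] by (auto simp: Q_def P.top_row_eq P.mem_P_iff)
  have "W' \<le> W" "Q.H \<le> P.H - 1"
    using Q.corners(2) P.P_subset Q.W_pos Q.H_pos unfolding Q_iff by auto
  moreover have "W + P.H - 1 = Suc (W' + Q.H - 1)"
    using size unfolding Q_def[symmetric] P.polyomino_size_eq Q.polyomino_size_eq .
  ultimately have W': "W' = W" and H': "P.H = Suc Q.H"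
    using Q.W_pos Q.H_pos by linarith+
  have sub: "{x. x < W \<and> t x = P.H} \<subseteq> {x. x < W' \<and> t' x = Q.H}"
  proof safe
    fix x assume x: "x < W" "t x = P.H"
    \<comment> \<open>Column \<open>x\<close> of the rest is nonempty because the widths agree.
      Hence column \<open>x\<close> of \<open>P\<close> has a cell below its top cell, and so it
      contains the cell directly below the top.\<close>
    then have "(x, b' x) \<in> Q" using Q.b_less_t by (simp add: Q.mem_P_iff W')
    then have "(x, Q.H - 1) \<in> Q"
      using x H' Q.H_pos unfolding Q_iff P.mem_P_iff by auto
    then show "t' x = Q.H" using Q.t_le_H[of x] Q.H_pos by (auto simp: Q.mem_P_iff)
  qed (simp add: W')
  have "card (top_row P) \<le> card (top_row Q)"
    unfolding P.card_top_row Q.card_top_row by (rule card_mono[OF _ sub]) simp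
  moreover have "top_row P = new_row Q (card (top_row P))"
  proof -
    have "right_side Q = W" using Q.right_side_eq W' by simp
    then show ?thesis
      unfolding new_row_def Q.top_side_eq
      by (subst P.top_row_eq, subst P.full_columns) (simp add: H')
  qed
  moreover have "1 \<le> card (top_row P)"
    using P.card_top_row_pos by simp
  ultimately show thesis
    unfolding Q_def by (intro that)
qed

text \<open>By the size hypothesis only the width changes, so the rest has the same top side. As
  bottoms are nondecreasing, the deleted column is no taller than the right column of the
  rest.\<close>

lemma delete_right_column:
  assumes "parallelogram_polyomino P" "parallelogram_polyomino (P - right_column P)"
    and size: "polyomino_size P = Suc (polyomino_size (P - right_column P))"
  obtains j where "1 \<le> j" "j \<le> card (right_column (P - right_column P))"
    "right_column P = new_column (P - right_column P) j"
proof -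
  define Q where "Q = P - right_column P"
  obtain W b t where "column_polyomino W b t P"
    using assms(1) by (rule parallelogram_polyominoE)
  then interpret P: column_polyomino W b t P .
  obtain W' b' t' where "column_polyomino W' b' t' Q"
    using assms(2) unfolding Q_def by (rule parallelogram_polyominoE)
  then interpret Q: column_polyomino W' b' t' Q .
  have Q_iff: "(x, y) \<in> Q \<longleftrightarrow> (x, y) \<in> P \<and> x < W - 1" for x y
    by (auto simp: Q_def right_column_def P.Max_fst P.mem_P_iff)
  have "W' \<le> W - 1" "Q.H \<le> P.H"
    using Q.corners(2) P.P_subset Q.W_pos Q.H_pos unfolding Q_iff by auto
  moreover have "W + P.H - 1 = Suc (W' + Q.H - 1)"
    using size unfolding Q_def[symmetric] P.polyomino_size_eq Q.polyomino_size_eq .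
  ultimately have W': "W = Suc W'" and H': "Q.H = P.H"
    using Q.W_pos Q.H_pos by linarith+
  have b: "b (W - 1) < P.H" using P.b_less_t[of "W - 1"] P.W_pos by (simp add: P.H_def)
  have "(W' - 1, b (W' - 1)) \<in> Q"
    unfolding Q_iff P.mem_P_iff using P.b_less_t[of "W' - 1"] Q.W_pos W' by simp
  then have "b' (W' - 1) \<le> b (W' - 1)" by (simp add: Q.mem_P_iff)
  also have "\<dots> \<le> b (W - 1)" using column_shape_mono[OF P.shape, of "W' - 1" "W - 1"] W' by simp
  finally have "P.H - b (W - 1) \<le> card (right_column Q)"
    unfolding Q.card_right_column H' by (rule diff_le_mono2)
  moreover have "right_column P = new_column Q (P.H - b (W - 1))"
  proof -
    have "W' = W - 1" "P.H - (P.H - b (W - 1)) = b (W - 1)" using b W' by simp_all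
    then show ?thesis
      unfolding new_column_def Q.right_side_eq Q.top_side_eq P.right_column_eq H' by simp
  qed
  moreover have "1 \<le> P.H - b (W - 1)"
    using b by simp
  ultimately show thesis
    unfolding Q_def by (intro that)
qed

lemma unit_cell_polyomino:
  "parallelogram_polyomino P \<and> polyomino_size P = 1 \<longleftrightarrow> P = {(0, 0)}"
proof
  assume P: "parallelogram_polyomino P \<and> polyomino_size P = 1"
  then obtain W b t where "column_polyomino W b t P"
    using parallelogram_polyominoE by blast
  then interpret P: column_polyomino W b t P .
  have "W + P.H - 1 = 1" using P P.polyomino_size_eq by simp
  then have "W = 1" "P.H = 1" using P.W_pos P.H_pos by linarith+
  then have "P \<subseteq> {0} \<times> {0}" using P.P_subset by (simp add: lessThan_Suc)
  then show "P = {(0, 0)}" using P.corners(1) by blast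
next
  assume P: "P = {(0, 0)}"
  have "column_polyomino 1 (\<lambda>_. 0) (\<lambda>_. 1) P"
    by unfold_locales (auto simp: column_shape_def columns_def P)
  then interpret P: column_polyomino 1 "\<lambda>_. 0" "\<lambda>_. 1" P .
  have "P.H = 1" unfolding P.H_def by simp
  then show "parallelogram_polyomino P \<and> polyomino_size P = 1"
    using P.parallelogram_polyomino P.polyomino_size_eq by simp
qed

section \<open>Counting labels of the rule\<close>

text \<open>A weighted hockey-stick identity, by downward induction on \<open>i\<close> from the
  empty sum \<open>i = Suc L\<close>; each new term is absorbed by Pascal's rule.\<close>

lemma sum_index_times_choose:
  assumes "i \<le> Suc L"
  shows "(\<Sum>a=i..L. real a * real ((L - a) choose m)) =
    real ((Suc L - i) choose (m + 2)) + real i * real ((Suc L - i) choose (m + 1))"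
  using assms
proof (induction i rule: inc_induct)
  case base
  then show ?case by simp
next
  case (step i)
  have d: "Suc L - i = Suc (L - i)" using step.hyps by simp
  have "(\<Sum>a=i..L. real a * real ((L - a) choose m)) =
      real i * real ((L - i) choose m) + (\<Sum>a=Suc i..L. real a * real ((L - a) choose m))"
    using step.hyps by (subst sum.atLeast_Suc_atMost) auto
  also note step.IH
  finally show ?case using d by (simp add: algebra_simps)
qed

section \<open>The closed form and its tail sums\<close>

definition bax_prefactor :: "nat \<Rightarrow> nat \<Rightarrow> real" where
  "bax_prefactor p q = real ((p + q + 2) choose (q + 1)) / (real (p + q + 1) * real (p + q + 2))"

text \<open>
  The formula for \<open>p, q > 0\<close> goes back to Chung, Graham, Hoggatt and Kleiman and to Mallows; it counts
  the slicings with \<open>p + 1\<close> rows, \<open>q + 1\<close> columns and label \<open>(i, j)\<close>. For \<open>p = 0\<close> or \<open>q = 0\<close>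
  only one label occurs.
\<close>

definition bax_count :: "nat \<Rightarrow> nat \<Rightarrow> nat \<Rightarrow> nat \<Rightarrow> real" where
  "bax_count p q i j =
     (if p = 0 then of_bool (i = q + 1 \<and> j = 1)
      else if q = 0 then of_bool (i = 1 \<and> j = p + 1)
      else real i * real j * bax_prefactor p q *
        (real ((p + q - i) choose (p - 1)) * real ((p + q - j) choose (q - 1)) -
         real ((p + q - i) choose p) * real ((p + q - j) choose q)))"

lemma bax_prefactor_sym: "bax_prefactor p q = bax_prefactor q p"
proof -
  have "(p + q + 2) choose (q + 1) = (q + p + 2) choose (p + 1)"
    by (subst binomial_symmetric) (auto simp: add.commute)
  then show ?thesis
    unfolding bax_prefactor_def by (simp only: add.commute[of p q])
qed

text \<open>Mirrors the exchange of rows and columns, so that in the recurrence the sum over the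
  second component follows from the sum over the first.\<close>

lemma bax_count_sym: "bax_count p q i j = bax_count q p j i"
  by (auto simp: bax_count_def bax_prefactor_sym[of p q] add.commute mult.commute)

lemma bax_count_0 [simp]: "bax_count p q i 0 = 0"
  by (simp add: bax_count_def)

lemma bax_count_0' [simp]: "bax_count p q 0 j = 0"
  by (simp add: bax_count_def)

lemma bax_prefactor_0: "q > 0 \<Longrightarrow> bax_prefactor 0 q = 1 / real (q + 1)"
  by (simp add: bax_prefactor_def divide_simps)

text \<open>Absorption, \<open>(N - k) * (N choose k) = N * (N - 1 choose k)\<close>, with
  \<open>N = p + q + 3\<close> and \<open>k = q + 1\<close>. With its mirror image it lets the
  prefactor cancel from the recurrence.\<close>

lemma bax_prefactor_Suc_left:
  "real (p + q + 1) * bax_prefactor p q = real (p + 2) * bax_prefactor (Suc p) q"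
proof -
  have "Suc (p + q + 2) * ((p + q + 2) choose (q + 1)) = (p + 2) * (Suc (p + q + 2) choose (q + 1))"
    using binomial_absorb_comp[of "Suc (p + q + 2)" "q + 1"] by simp
  then have "real (p + q + 3) * real ((p + q + 2) choose (q + 1)) = real (p + 2) * real ((p + q + 3) choose (q + 1))"
    by (metis of_nat_mult add_Suc_right numeral_3_eq_3 numeral_2_eq_2)
  then have "real ((p + q + 2) choose (q + 1)) = real (p + 2) * real ((p + q + 3) choose (q + 1)) / real (p + q + 3)"
    by (simp add: field_simps del: binomial_Suc_Suc)
  moreover have "bax_prefactor (Suc p) q = real ((p + q + 3) choose (q + 1)) / (real (p + q + 2) * real (p + q + 3))"
    unfolding bax_prefactor_def by (simp add: numeral_3_eq_3 del: binomial_Suc_Suc)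
  ultimately show ?thesis
    unfolding bax_prefactor_def by (simp del: binomial_Suc_Suc of_nat_add)
qed

lemma bax_prefactor_Suc_right:
  "real (p + q + 1) * bax_prefactor p q = real (q + 2) * bax_prefactor p (Suc q)"
  using bax_prefactor_Suc_left[of q p] by (simp add: bax_prefactor_sym[of p] add.commute)

text \<open>Only the factors containing \<open>a\<close> vary, and they are summed by
  \<open>sum_index_times_choose\<close>. The result contains no \<open>p - 1\<close> and stays
  correct for \<open>p = 0\<close>, where \<open>bax_count\<close> is an indicator; the recurrence
  can thus treat a neighbour with \<open>p = 0\<close> like any other.\<close>

lemma sum_bax_count_left:
  assumes "q > 0" "1 \<le> i" "i \<le> q + 1" "1 \<le> j" "j \<le> p + 1"
  shows "(\<Sum>a=i..q+1. bax_count p q a j) = real j * bax_prefactor p q *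
    ((real ((p + q + 1 - i) choose (p + 1)) + real i * real ((p + q + 1 - i) choose p)) * real ((p + q - j) choose (q - 1)) -
     (real ((p + q + 1 - i) choose (p + 2)) + real i * real ((p + q + 1 - i) choose (p + 1))) * real ((p + q - j) choose q))"
proof (cases "p = 0")
  case True
  with assms have j: "j = 1" by simp
  have "(\<Sum>a=i..q+1. bax_count p q a j) = (\<Sum>a=i..q+1. if a = q + 1 then 1 else 0)"
    using True j by (intro sum.cong) (auto simp: bax_count_def)
  also have "\<dots> = 1" using assms by (subst sum.delta) auto
  finally have l: "(\<Sum>a=i..q+1. bax_count p q a j) = 1" .
  \<comment> \<open>For \<open>p = 0\<close> and \<open>j = 1\<close> the subtracted product
    contains \<open>(q - 1) choose q = 0\<close>, and the sum given here cancels the prefactor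
    \<open>1 / (q + 1)\<close>.\<close>
  have "real (Suc q - i) + real i = real q + 1" using assms by simp
  then show ?thesis unfolding l using True j assms
    by (simp add: bax_prefactor_0)
next
  case False
  \<comment> \<open>For \<open>a > q + 1\<close> the upper index \<open>p + q - a\<close> is below
    \<open>m\<close>, so the summation may run up to \<open>p + q\<close>.\<close>
  have tail: "(\<Sum>a=i..q+1. real a * real ((p + q - a) choose m)) =
     real ((p + q + 1 - i) choose (m + 2)) + real i * real ((p + q + 1 - i) choose (m + 1))" if "m \<ge> p - 1" for m
  proof -
    have "(\<Sum>a=i..q+1. real a * real ((p + q - a) choose m)) = (\<Sum>a=i..p+q. real a * real ((p + q - a) choose m))"
      using False that by (intro sum.mono_neutral_left) (auto intro!: binomial_eq_0)
    also have "\<dots> = real ((p + q + 1 - i) choose (m + 2)) + real i * real ((p + q + 1 - i) choose (m + 1))"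
      using assms by (subst sum_index_times_choose) auto
    finally show ?thesis .
  qed
  have "(\<Sum>a=i..q+1. bax_count p q a j) =
    real j * bax_prefactor p q * ((\<Sum>a=i..q+1. real a * real ((p + q - a) choose (p - 1))) * real ((p + q - j) choose (q - 1))
      - (\<Sum>a=i..q+1. real a * real ((p + q - a) choose p)) * real ((p + q - j) choose q))"
    using False assms unfolding sum_distrib_left sum_distrib_right sum_subtractf[symmetric]
    by (intro sum.cong) (auto simp: bax_count_def algebra_simps)
  also have "\<dots> = real j * bax_prefactor p q *
    ((real ((p + q + 1 - i) choose (p + 1)) + real i * real ((p + q + 1 - i) choose p)) * real ((p + q - j) choose (q - 1)) -
     (real ((p + q + 1 - i) choose (p + 2)) + real i * real ((p + q + 1 - i) choose (p + 1))) * real ((p + q - j) choose q))"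
    using False by (subst (1 2) tail) auto
  finally show ?thesis .
qed

section \<open>The recurrence for the closed form\<close>

lemma choose_Suc_times: "real (Suc k) * real (n choose Suc k) = (real n - real k) * real (n choose k)"
proof (cases "k \<le> n")
  case True
  have "Suc k * (n choose Suc k) = (n - k) * (n choose k)"
    using binomial_absorption[of k n] binomial_absorb_comp[of n k]  by simp
  then have "real (Suc k) * real (n choose Suc k) = real (n - k) * real (n choose k)"
    by (metis of_nat_mult)
  with True show ?thesis by (simp add: of_nat_diff)
\<comment> \<open>For \<open>k > n\<close> the real difference is negative, but both binomials
  vanish.\<close>
qed (simp add: binomial_eq_0)

text \<open>\<open>A\<close>, \<open>A1\<close>, \<open>A2\<close> stand for the binomials with
  upper index \<open>p + q - i\<close> and lower indices \<open>p - 1\<close>, \<open>p\<close>,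
  \<open>p + 1\<close>; \<open>B\<close>, \<open>B1\<close>, \<open>B2\<close> arise by exchanging
  \<open>p\<close>, \<open>i\<close> with \<open>q\<close>, \<open>j\<close>. The hypotheses express
  everything through \<open>A / p\<close> and \<open>B / q\<close>.\<close>

lemma bax_poly_identity:
  fixes p q i j :: real
  assumes pq: "p \<noteq> 0" "q \<noteq> 0"
    and A: "p * A1 = (q + 1 - i) * A" "(p + 1) * A2 = (q - i) * A1"
    and B: "q * B1 = (p + 1 - j) * B" "(q + 1) * B2 = (p - j) * B1"
  shows "(p + q) * (i * j * (A * B - A1 * B1)) =
    (p + 1) * ((j - 1) * ((A1 + i * A) * B - (A2 + i * A1) * B1)) +
    (q + 1) * ((i - 1) * ((B1 + j * B) * A - (B2 + j * B1) * A1))"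
proof -
  define x y where "x = A / p" and "y = B / q"
  have xy: "A = p * x" "B = q * y" using pq by (simp_all add: x_def y_def)
  have A1: "A1 = (q + 1 - i) * x" using A(1) pq by (simp add: x_def field_simps)
  have B1: "B1 = (p + 1 - j) * y" using B(1) pq by (simp add: y_def field_simps)
  \<comment> \<open>The factor \<open>p + 1\<close> is moved inside to meet \<open>A2\<close>, which
    can then be replaced without division.\<close>
  have "(p + 1) * ((j - 1) * ((A1 + i * A) * B - (A2 + i * A1) * B1)) =
     (j - 1) * (((p + 1) * A1 + (p + 1) * i * A) * B - ((p + 1) * A2 + (p + 1) * i * A1) * B1)"
    by (simp add: algebra_simps)
  moreover have "(q + 1) * ((i - 1) * ((B1 + j * B) * A - (B2 + j * B1) * A1)) =
     (i - 1) * (((q + 1) * B1 + (q + 1) * j * B) * A - ((q + 1) * B2 + (q + 1) * j * B1) * A1)"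
    by (simp add: algebra_simps)
  ultimately show ?thesis
    unfolding A(2) B(2) unfolding A1 B1 xy by (simp add: algebra_simps)
qed

text \<open>The succession rule read backwards: label \<open>(i, j)\<close> arises from
  \<open>(a, j - 1)\<close> with \<open>a \<ge> i\<close> by a row of width \<open>i\<close>, or
  from \<open>(i - 1, b)\<close> with \<open>b \<ge> j\<close> by a column of height
  \<open>j\<close>.\<close>

lemma bax_count_rec:
  assumes "p + q > 0" "1 \<le> i" "i \<le> q + 1" "1 \<le> j" "j \<le> p + 1"
  shows "bax_count p q i j =
    (if p = 0 then 0 else \<Sum>a=i..q+1. bax_count (p - 1) q a (j - 1)) +
    (if q = 0 then 0 else \<Sum>b=j..p+1. bax_count p (q - 1) (i - 1) b)"
proof -
  consider "p = 0" "q > 0" | "q = 0" "p > 0" | p' q' where "p = Suc p'" "q = Suc q'"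
    using assms by (metis add_gr_0 gr0_conv_Suc neq0_conv)
  then show ?thesis
  proof cases
    case 1
    with assms show ?thesis by (auto simp: bax_count_def)
  next
    case 2
    with assms show ?thesis by (auto simp: bax_count_def)
  next
    case 3
    define N M where "N = p' + q' + 2 - i" and "M = p' + q' + 2 - j"
    have N: "real N = real p' + real q' + 2 - real i" and M: "real M = real p' + real q' + 2 - real j"
      using assms 3 by (auto simp: N_def M_def of_nat_diff)
    have s1: "(\<Sum>a=i..q+1. bax_count p' q a (j - 1)) = (real j - 1) * bax_prefactor p' q *
      ((real (N choose p) + real i * real (N choose p')) * real (M choose q') -
       (real (N choose Suc p) + real i * real (N choose p)) * real (M choose q))"
    \<comment> \<open>For \<open>j = 1\<close> both sides vanish, by \<open>bax_count_0\<close> and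
      by the factor \<open>real j - 1\<close>.\<close>
    proof (cases "j = 1")
      case False
      have e: "p' + q + 1 - i = N" "p' + q - (j - 1) = M" "real (j - 1) = real j - 1" "p' + 1 = p" "p' + 2 = Suc p" "q - 1 = q'"
        using False assms 3 by (auto simp: N_def M_def)
      have "(\<Sum>a=i..q+1. bax_count p' q a (j - 1)) = real (j - 1) * bax_prefactor p' q *
    ((real ((p' + q + 1 - i) choose (p' + 1)) + real i * real ((p' + q + 1 - i) choose p')) * real ((p' + q - (j - 1)) choose (q - 1)) -
     (real ((p' + q + 1 - i) choose (p' + 2)) + real i * real ((p' + q + 1 - i) choose (p' + 1))) * real ((p' + q - (j - 1)) choose q))"
        using False assms 3 by (intro sum_bax_count_left) auto
      then show ?thesis unfolding e .
    qed simp
    have s2: "(\<Sum>b=j..p+1. bax_count p q' (i - 1) b) = (real i - 1) * bax_prefactor p q' *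
      ((real (M choose q) + real j * real (M choose q')) * real (N choose p') -
       (real (M choose Suc q) + real j * real (M choose q)) * real (N choose p))"
    proof (cases "i = 1")
      case False
      have e: "q' + p + 1 - j = M" "q' + p - (i - 1) = N" "real (i - 1) = real i - 1" "q' + 1 = q" "q' + 2 = Suc q" "p - 1 = p'"
        using False assms 3 by (auto simp: N_def M_def)
      have "(\<Sum>b=j..p+1. bax_count q' p b (i - 1)) = real (i - 1) * bax_prefactor q' p *
    ((real ((q' + p + 1 - j) choose (q' + 1)) + real j * real ((q' + p + 1 - j) choose q')) * real ((q' + p - (i - 1)) choose (p - 1)) -
     (real ((q' + p + 1 - j) choose (q' + 2)) + real j * real ((q' + p + 1 - j) choose (q' + 1))) * real ((q' + p - (i - 1)) choose p))"
        using False assms 3 by (intro sum_bax_count_left) auto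
      then show ?thesis unfolding e bax_count_sym[of q' p] bax_prefactor_sym[of q' p] .
    qed simp
    have l: "bax_count p q i j = real i * real j * bax_prefactor p q *
       (real (N choose p') * real (M choose q') - real (N choose p) * real (M choose q))"
      using 3 by (simp add: bax_count_def N_def M_def)
    \<comment> \<open>Multiplication by \<open>p + q\<close> turns the prefactors of both neighbours
      into multiples of \<open>bax_prefactor p q\<close>.\<close>
    have P1: "real (p + q) * bax_prefactor p' q = real (p + 1) * bax_prefactor p q"
      using bax_prefactor_Suc_left[of p' q] 3 by simp
    have P2: "real (p + q) * bax_prefactor p q' = real (q + 1) * bax_prefactor p q"
      using bax_prefactor_Suc_right[of p q'] 3 by simp
    have id: "(real p + real q) * (real i * real j * (real (N choose p') * real (M choose q') - real (N choose p) * real (M choose q))) =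
      (real p + 1) * ((real j - 1) * ((real (N choose p) + real i * real (N choose p')) * real (M choose q') -
       (real (N choose Suc p) + real i * real (N choose p)) * real (M choose q))) +
      (real q + 1) * ((real i - 1) * ((real (M choose q) + real j * real (M choose q')) * real (N choose p') -
       (real (M choose Suc q) + real j * real (M choose q)) * real (N choose p)))"
    proof (rule bax_poly_identity)
      show "real p * real (N choose p) = (real q + 1 - real i) * real (N choose p')"
        using choose_Suc_times[of p' N] 3 N by simp
      show "(real p + 1) * real (N choose Suc p) = (real q - real i) * real (N choose p)"
        using choose_Suc_times[of p N] 3 N by (simp add: algebra_simps)
      show "real q * real (M choose q) = (real p + 1 - real j) * real (M choose q')"
        using choose_Suc_times[of q' M] 3 M by simp
      show "(real q + 1) * real (M choose Suc q) = (real p - real j) * real (M choose q)"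
        using choose_Suc_times[of q M] 3 M by (simp add: algebra_simps)
    qed (use 3 in auto)
    have "real (p + q) * bax_count p q i j =
      real (p + q) * ((\<Sum>a=i..q+1. bax_count p' q a (j - 1)) + (\<Sum>b=j..p+1. bax_count p q' (i - 1) b))"
    proof -
      have "real (p + q) * bax_count p q i j = bax_prefactor p q * ((real p + real q) * (real i * real j * (real (N choose p') * real (M choose q') - real (N choose p) * real (M choose q))))"
        unfolding l by simp
      also have "\<dots> = (real (p + 1) * bax_prefactor p q) * ((real j - 1) * ((real (N choose p) + real i * real (N choose p')) * real (M choose q') -
       (real (N choose Suc p) + real i * real (N choose p)) * real (M choose q))) +
      (real (q + 1) * bax_prefactor p q) * ((real i - 1) * ((real (M choose q) + real j * real (M choose q')) * real (N choose p') -
       (real (M choose Suc q) + real j * real (M choose q)) * real (N choose p)))"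
        unfolding id by (simp only: of_nat_add of_nat_1 distrib_left) (simp only: mult_ac)
      also have "\<dots> = real (p + q) * ((\<Sum>a=i..q+1. bax_count p' q a (j - 1)) + (\<Sum>b=j..p+1. bax_count p q' (i - 1) b))"
        unfolding s1 s2 P1[symmetric] P2[symmetric] by (simp only: distrib_left mult_ac)
      finally show ?thesis .
    qed
    then show ?thesis using 3 by simp
  qed
qed

section \<open>Totals over all labels and the Baxter numbers\<close>

lemma bax_count_total:
  "(\<Sum>i=1..q+1. \<Sum>j=1..p+1. bax_count p q i j) =
   real ((p + q + 2) choose q) * real ((p + q + 2) choose (q + 1)) * real ((p + q + 2) choose (q + 2)) /
     (real ((p + q + 2) choose 1) * real ((p + q + 2) choose 2))"
proof (cases "p = 0 \<or> q = 0")
  case True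
  \<comment> \<open>In both degenerate cases the only label is
    \<open>(q + 1, p + 1)\<close>.\<close>
  have "(\<Sum>i=1..q+1. \<Sum>j=1..p+1. bax_count p q i j) = (\<Sum>i=1..q+1. \<Sum>j=1..p+1. if i = q + 1 then if j = p + 1 then 1 else 0 else 0)"
    using True by (intro sum.cong) (auto simp: bax_count_def)
  also have "\<dots> = (\<Sum>i=1..q+1. if i = q + 1 then (\<Sum>j=1..p+1. if j = p + 1 then 1 else 0) else 0)"
    by (intro sum.cong) auto
  also have "\<dots> = 1"
    by (simp add: sum.delta)
  finally have tot: "(\<Sum>i=1..q+1. \<Sum>j=1..p+1. bax_count p q i j) = 1" .
  have "((p + q + 2) choose q) * ((p + q + 2) choose (q + 1)) * ((p + q + 2) choose (q + 2)) =
      ((p + q + 2) choose 1) * ((p + q + 2) choose 2)"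
    using True
  proof
    assume "p = 0"
    then show ?thesis
      using binomial_symmetric[of q "q + 2"] binomial_symmetric[of "q + 1" "q + 2"]
      by (simp del: binomial_Suc_Suc add: mult.commute)
  next
    assume "q = 0"
    then show ?thesis by (simp del: binomial_Suc_Suc add: numeral_2_eq_2)
  qed
  then have eq: "real (((p + q + 2) choose q) * ((p + q + 2) choose (q + 1)) * ((p + q + 2) choose (q + 2))) =
      real (((p + q + 2) choose 1) * ((p + q + 2) choose 2))"
    by (rule arg_cong)
  have "(p + q + 2) choose 1 > 0" "(p + q + 2) choose 2 > 0"
    by (rule zero_less_binomial; simp)+
  then have "real (((p + q + 2) choose 1) * ((p + q + 2) choose 2)) \<noteq> 0"
    by (metis of_nat_eq_0_iff mult_is_0 less_not_refl)
  from divide_self[OF this] show ?thesis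
    unfolding tot of_nat_mult[symmetric] eq by (rule sym)
next
  case False
  define n where "n = p + q + 1"
  have tail: "(\<Sum>j=1..p+1. real j * real ((p + q - j) choose m)) = real (n choose (m + 2))" if "m \<ge> q - 1" for m
  proof -
    have "(\<Sum>j=1..p+1. real j * real ((p + q - j) choose m)) = (\<Sum>j=1..p+q. real j * real ((p + q - j) choose m))"
      using False that by (intro sum.mono_neutral_left) (auto intro!: binomial_eq_0)
    also have "\<dots> = real (n choose (m + 2))"
      by (subst sum_index_times_choose) (auto simp: n_def)
    finally show ?thesis .
  qed
  have "(\<Sum>i=1..q+1. \<Sum>j=1..p+1. bax_count p q i j) = (\<Sum>j=1..p+1. \<Sum>i=1..q+1. bax_count p q i j)"
    by (rule sum.swap)
  also have "\<dots> = (\<Sum>j=1..p+1. bax_prefactor p q * (real (n choose (p + 1)) * (real j * real ((p + q - j) choose (q - 1))) -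
      real (n choose (p + 2)) * (real j * real ((p + q - j) choose q))))"
    using False by (intro sum.cong refl, subst sum_bax_count_left) (auto simp: n_def algebra_simps)
  also have "\<dots> = bax_prefactor p q * (real (n choose (p + 1)) * (\<Sum>j=1..p+1. real j * real ((p + q - j) choose (q - 1))) -
      real (n choose (p + 2)) * (\<Sum>j=1..p+1. real j * real ((p + q - j) choose q)))"
    by (simp only: sum_distrib_left sum_subtractf right_diff_distrib)
  also have "\<dots> = bax_prefactor p q * (real (n choose (p + 1)) * real (n choose (q + 1)) - real (n choose (p + 2)) * real (n choose (q + 2)))"
    using False by (subst (1 2) tail) auto
  finally have tot: "(\<Sum>i=1..q+1. \<Sum>j=1..p+1. bax_count p q i j) = \<dots>" .
  obtain q' where q': "q = Suc q'" using False by (cases q) auto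
  \<comment> \<open>Four consecutive entries of row \<open>n\<close> of Pascal's triangle.
    Neighbours add up to the three binomials of the claim, and \<open>v + w\<close> is the one that
    the prefactor already contains.\<close>
  define u v w z where "u = real (n choose q')" and "v = real (n choose q)" and "w = real (n choose (q+1))" and "z = real (n choose (q+2))"
  have sym: "n choose (p + 1) = n choose q" "n choose (p + 2) = n choose q'"
    using binomial_symmetric[of "p + 1" n] binomial_symmetric[of "p + 2" n] q' by (auto simp: n_def)
  have uv: "real q * v = (real p + 2) * u"
    using choose_Suc_times[of q' n] by (simp add: v_def u_def q' n_def algebra_simps)
  have wz: "(real q + 2) * z = real p * w"
    using choose_Suc_times[of "q+1" n] by (simp add: z_def w_def n_def algebra_simps)
  have c: "real ((p + q + 2) choose q) = u + v" "real ((p + q + 2) choose (q + 1)) = v + w" "real ((p + q + 2) choose (q + 2)) = w + z"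
    by (simp_all add: u_def v_def w_def z_def n_def q')
  have c2: "real ((p + q + 2) choose 2) = real (p + q + 2) * real (p + q + 1) / 2"
  proof -
    have "2 * ((p + q + 2) choose 2) = (p + q + 2) * (p + q + 1)"
      by (simp add: choose_two)
    then have "2 * real ((p + q + 2) choose 2) = real (p + q + 2) * real (p + q + 1)"
      by (metis of_nat_mult of_nat_numeral)
    then show ?thesis by (simp del: of_nat_add binomial_Suc_Suc)
  qed
  have key: "(real p + real q + 2) * (v * w - u * z) = 2 * ((u + v) * (w + z))"
  proof -
    \<comment> \<open>These are the common factors in \<open>u : v = q : (p + 2)\<close> and
      \<open>z : w = p : (q + 2)\<close>. Both sides become
      \<open>2 * (p + q + 2)^2 * s * r\<close>.\<close>
    define s r where "s = v / (real p + 2)" and "r = w / (real q + 2)"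
    have nz: "real q + 2 \<noteq> 0" "real p + 2 \<noteq> 0" by linarith+
    have "v = (real p + 2) * s" "w = (real q + 2) * r" using nz by (simp_all add: s_def r_def)
    moreover have "u = real q * s" "z = real p * r"
      using uv wz nz by (simp_all add: s_def r_def field_simps)
    ultimately show ?thesis by (simp add: algebra_simps)
  qed
  have pf: "bax_prefactor p q = (v + w) / (real (p + q + 1) * real (p + q + 2))"
    unfolding bax_prefactor_def c ..
  have "bax_prefactor p q * (v * w - u * z) = (u + v) * (v + w) * (w + z) / (real (p + q + 2) * (real (p + q + 2) * real (p + q + 1) / 2))"
  proof -
    have nz: "real (p + q + 1) \<noteq> 0" "real (p + q + 2) \<noteq> 0" by linarith+
    have k: "v * w - u * z = 2 * ((u + v) * (w + z)) / real (p + q + 2)"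
      using key nz by (simp add: field_simps)
    show ?thesis unfolding k pf by (simp add: mult_ac)
  qed
  then show ?thesis unfolding tot sym c c2 u_def[symmetric] v_def[symmetric] w_def[symmetric] z_def[symmetric] by simp
qed

text \<open>The summand with index \<open>k\<close> of the Baxter number is the total of
  \<open>bax_count p q\<close> for \<open>q + 1 = k\<close>.\<close>

lemma baxter_number_eq_sum_bax_count:
  "baxter_number (Suc m) = (\<Sum>p\<le>m. \<Sum>i=1..m-p+1. \<Sum>j=1..p+1. bax_count p (m - p) i j)"
proof -
  have "(\<Sum>p\<le>m. \<Sum>i=1..m-p+1. \<Sum>j=1..p+1. bax_count p (m - p) i j) =
     (\<Sum>p\<le>m. real ((m + 2) choose (m - p)) * real ((m + 2) choose (m - p + 1)) * real ((m + 2) choose (m - p + 2)) /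
     (real ((m + 2) choose 1) * real ((m + 2) choose 2)))"
    by (intro sum.cong refl, subst bax_count_total) auto
  also have "\<dots> = baxter_number (Suc m)"
    unfolding baxter_number_def
    by (rule sum.reindex_bij_witness[of _ "\<lambda>k. m + 1 - k" "\<lambda>p. m - p + 1"]) auto
  finally show ?thesis ..
qed

section \<open>Passing from one level of the rule to the next\<close>

definition bax_level_sum :: "nat \<Rightarrow> (nat \<times> nat \<Rightarrow> real) \<Rightarrow> real" where
  "bax_level_sum m f = (\<Sum>p\<le>m. \<Sum>i=1..m-p+1. \<Sum>j=1..p+1. bax_count p (m - p) i j * f (i, j))"

text \<open>Turns a sum over the children of each label into a sum over the possible parents of each
  label.\<close>

lemma sum_triangle_swap:
  fixes g :: "nat \<Rightarrow> real"
  shows "(\<Sum>h=1..n. g h * (\<Sum>i=1..h. f i)) = (\<Sum>i=1..n. (\<Sum>h=i..n. g h) * f i)"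
proof -
  have "(\<Sum>h=1..n. g h * (\<Sum>i=1..h. f i)) = (\<Sum>h=1..n. \<Sum>i\<in>{i\<in>{1..n}. i \<le> h}. g h * f i)"
    unfolding sum_distrib_left by (intro sum.cong) auto
  also have "\<dots> = (\<Sum>i=1..n. \<Sum>h\<in>{h\<in>{1..n}. i \<le> h}. g h * f i)"
    by (rule sum.swap_restrict) auto
  also have "\<dots> = (\<Sum>i=1..n. (\<Sum>h=i..n. g h) * f i)"
    unfolding sum_distrib_right by (intro sum.cong) auto
  finally show ?thesis .
qed

text \<open>The operator that sends \<open>f\<close> to its sum over the children of a label is
  moved from \<open>f\<close> to \<open>bax_count\<close>, where \<open>bax_count_rec\<close>
  recognises the next level. \<open>R\<close> and \<open>C\<close> are the row and the column part
  of that recurrence.\<close>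

lemma bax_level_sum_Suc:
  "bax_level_sum m (\<lambda>(h, k). (\<Sum>i=1..h. f (i, k + 1)) + (\<Sum>j=1..k. f (h + 1, j))) = bax_level_sum (Suc m) f"
proof -
  define R where "R p q i j = (if p = 0 then 0 else \<Sum>a=i..q+1. bax_count (p - 1) q a (j - 1))" for p q i j
  define C where "C p q i j = (if q = 0 then 0 else \<Sum>b=j..p+1. bax_count p (q - 1) (i - 1) b)" for p q i j
  have R: "(\<Sum>i=1..q+1. \<Sum>j=1..p+1. bax_count p q i j * (\<Sum>i'=1..i. f (i', j + 1))) =
     (\<Sum>i=1..q+1. \<Sum>j=1..Suc p+1. R (Suc p) q i j * f (i, j))" for p q
  proof -
    have "(\<Sum>i=1..q+1. \<Sum>j=1..p+1. bax_count p q i j * (\<Sum>i'=1..i. f (i', j + 1))) =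
      (\<Sum>j=1..p+1. \<Sum>i=1..q+1. bax_count p q i j * (\<Sum>i'=1..i. f (i', j + 1)))" by (rule sum.swap)
    also have "\<dots> = (\<Sum>j=1..p+1. \<Sum>i=1..q+1. (\<Sum>h=i..q+1. bax_count p q h j) * f (i, j + 1))"
      by (subst sum_triangle_swap) simp
    also have "\<dots> = (\<Sum>i=1..q+1. \<Sum>j=1..p+1. (\<Sum>h=i..q+1. bax_count p q h j) * f (i, j + 1))" by (rule sum.swap)
    also have "\<dots> = (\<Sum>i=1..q+1. \<Sum>j=1..Suc p+1. R (Suc p) q i j * f (i, j))"
    proof (rule sum.cong[OF refl])
      fix i
      \<comment> \<open>The term \<open>j = 1\<close> vanishes because it only contains values
        \<open>bax_count p q a 0\<close>.\<close>
      have "(\<Sum>j=1..Suc p+1. R (Suc p) q i j * f (i, j)) = (\<Sum>j=Suc 1..Suc (p+1). R (Suc p) q i j * f (i, j))"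
        by (subst sum.atLeast_Suc_atMost) (auto simp: R_def)
      also have "\<dots> = (\<Sum>j=1..p+1. (\<Sum>h=i..q+1. bax_count p q h j) * f (i, j + 1))"
        by (subst sum.shift_bounds_cl_Suc_ivl) (auto simp: R_def)
      finally show "(\<Sum>j=1..p+1. (\<Sum>h=i..q+1. bax_count p q h j) * f (i, j + 1)) = (\<Sum>j=1..Suc p+1. R (Suc p) q i j * f (i, j))" ..
    qed
    finally show ?thesis .
  qed
  have C: "(\<Sum>i=1..q+1. \<Sum>j=1..p+1. bax_count p q i j * (\<Sum>j'=1..j. f (i + 1, j'))) =
     (\<Sum>i=1..Suc q+1. \<Sum>j=1..p+1. C p (Suc q) i j * f (i, j))" for p q
  proof -
    have "(\<Sum>i=1..q+1. \<Sum>j=1..p+1. bax_count p q i j * (\<Sum>j'=1..j. f (i + 1, j'))) =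
       (\<Sum>i=1..q+1. \<Sum>j=1..p+1. (\<Sum>h=j..p+1. bax_count p q i h) * f (i + 1, j))"
      by (subst sum_triangle_swap) simp
    moreover have "(\<Sum>i=1..Suc q+1. \<Sum>j=1..p+1. C p (Suc q) i j * f (i, j)) = (\<Sum>i=Suc 1..Suc (q+1). \<Sum>j=1..p+1. C p (Suc q) i j * f (i, j))"
        by (subst sum.atLeast_Suc_atMost) (auto simp: C_def)
    moreover have "\<dots> = (\<Sum>i=1..q+1. \<Sum>j=1..p+1. (\<Sum>h=j..p+1. bax_count p q i h) * f (i + 1, j))"
        by (subst sum.shift_bounds_cl_Suc_ivl) (auto simp: C_def)
    ultimately show ?thesis by simp
  qed
  have "bax_level_sum (Suc m) f = (\<Sum>p\<le>Suc m. \<Sum>i=1..Suc m-p+1. \<Sum>j=1..p+1. R p (Suc m - p) i j * f (i, j) + C p (Suc m - p) i j * f (i, j))"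
    unfolding bax_level_sum_def distrib_right[symmetric] R_def C_def
    by (intro sum.cong refl, subst bax_count_rec) auto
  also have "\<dots> = (\<Sum>p\<le>Suc m. \<Sum>i=1..Suc m-p+1. \<Sum>j=1..p+1. R p (Suc m - p) i j * f (i, j)) +
     (\<Sum>p\<le>Suc m. \<Sum>i=1..Suc m-p+1. \<Sum>j=1..p+1. C p (Suc m - p) i j * f (i, j))"
    by (simp only: sum.distrib)
  \<comment> \<open>\<open>R\<close> vanishes for \<open>p = 0\<close> and \<open>C\<close> for
    \<open>q = 0\<close>. Each of the two sums thus loses one index and becomes a sum over level
    \<open>m\<close>.\<close>
  also have "(\<Sum>p\<le>Suc m. \<Sum>i=1..Suc m-p+1. \<Sum>j=1..p+1. R p (Suc m - p) i j * f (i, j)) =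
     (\<Sum>p\<le>m. \<Sum>i=1..m-p+1. \<Sum>j=1..Suc p+1. R (Suc p) (m - p) i j * f (i, j))"
    by (subst sum.atMost_Suc_shift) (simp add: R_def)
  also have "(\<Sum>p\<le>Suc m. \<Sum>i=1..Suc m-p+1. \<Sum>j=1..p+1. C p (Suc m - p) i j * f (i, j)) =
     (\<Sum>p\<le>m. \<Sum>i=1..Suc (m-p)+1. \<Sum>j=1..p+1. C p (Suc (m - p)) i j * f (i, j))"
    by (simp add: Suc_diff_le C_def)
  finally show ?thesis
    unfolding bax_level_sum_def R[symmetric] C[symmetric]
    by (simp only: distrib_left sum.distrib split)
qed

section \<open>The tree of Baxter slicings\<close>

lemma baxter_slicing_polyomino:
  assumes "baxter_slicing n P S"
  shows "parallelogram_polyomino P" "polyomino_size P = n" "n \<ge> 1" "\<Union>S = P"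
proof -
  have "parallelogram_polyomino P \<and> polyomino_size P = n \<and> n \<ge> 1 \<and> \<Union>S = P"
    using assms by induction (auto simp: top_row_def right_column_def)
  then show "parallelogram_polyomino P" "polyomino_size P = n" "n \<ge> 1" "\<Union>S = P" by blast+
qed

lemma baxter_slicings_1: "baxter_slicings 1 = {({(0, 0)}, {{(0, 0)}})}"
proof -
  have "baxter_slicing n P S \<Longrightarrow> n = 1 \<Longrightarrow> P = {(0, 0)} \<and> S = {{(0, 0)}}" for n P S
  proof (induction rule: baxter_slicing.induct)
    case (single P)
    then show ?case using unit_cell_polyomino by blast
  qed (use baxter_slicing_polyomino(3) in fastforce)+
  moreover have "baxter_slicing 1 {(0, 0)} {{(0, 0)}}"
    using unit_cell_polyomino[of "{(0, 0)}"] by (intro baxter_slicing.single) auto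
  ultimately show ?thesis unfolding baxter_slicings_def by blast
qed

definition slicing_degree :: "slicing \<Rightarrow> nat" where
  "slicing_degree B = fst (slicing_label B) + snd (slicing_label B)"

text \<open>The order of the children agrees with that of the labels in \<^const>\<open>Bax\<close>.\<close>

definition slicing_child :: "slicing \<Rightarrow> nat \<Rightarrow> slicing" where
  "slicing_child B i = (if i < fst (slicing_label B) then add_row B (Suc i)
     else add_column B (Suc (i - fst (slicing_label B))))"

text \<open>Translates between the sizes of the new block, which start at 1, and the child indices,
  which start at 0 and list rows before columns.\<close>

lemma ex_slicing_child_iff:
  "(\<exists>i<slicing_degree B. C = slicing_child B i) \<longleftrightarrow>
     (\<exists>i. 1 \<le> i \<and> i \<le> fst (slicing_label B) \<and> C = add_row B i) \<or>
     (\<exists>j. 1 \<le> j \<and> j \<le> snd (slicing_label B) \<and> C = add_column B j)"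
proof
  assume "\<exists>i<slicing_degree B. C = slicing_child B i"
  then obtain i where i: "i < slicing_degree B" "C = slicing_child B i" by blast
  show "(\<exists>i. 1 \<le> i \<and> i \<le> fst (slicing_label B) \<and> C = add_row B i) \<or>
     (\<exists>j. 1 \<le> j \<and> j \<le> snd (slicing_label B) \<and> C = add_column B j)"
  proof (cases "i < fst (slicing_label B)")
    case True
    then have "1 \<le> Suc i \<and> Suc i \<le> fst (slicing_label B) \<and> C = add_row B (Suc i)"
      using i by (simp add: slicing_child_def)
    then show ?thesis by blast
  next
    case False
    then have "1 \<le> Suc (i - fst (slicing_label B)) \<and> Suc (i - fst (slicing_label B)) \<le> snd (slicing_label B) \<and>
        C = add_column B (Suc (i - fst (slicing_label B)))"
      using i by (auto simp: slicing_child_def slicing_degree_def)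
    then show ?thesis by blast
  qed
next
  assume "(\<exists>i. 1 \<le> i \<and> i \<le> fst (slicing_label B) \<and> C = add_row B i) \<or>
     (\<exists>j. 1 \<le> j \<and> j \<le> snd (slicing_label B) \<and> C = add_column B j)"
  then show "\<exists>i<slicing_degree B. C = slicing_child B i"
  proof
    assume "\<exists>i. 1 \<le> i \<and> i \<le> fst (slicing_label B) \<and> C = add_row B i"
    then obtain i where "1 \<le> i" "i \<le> fst (slicing_label B)" "C = add_row B i" by blast
    then show ?thesis
      by (intro exI[of _ "i - 1"]) (auto simp: slicing_child_def slicing_degree_def)
  next
    assume "\<exists>j. 1 \<le> j \<and> j \<le> snd (slicing_label B) \<and> C = add_column B j"
    then obtain j where "1 \<le> j" "j \<le> snd (slicing_label B)" "C = add_column B j" by blast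
    then show ?thesis
      by (intro exI[of _ "fst (slicing_label B) + j - 1"]) (auto simp: slicing_child_def slicing_degree_def)
  qed
qed

lemma baxter_slicing_add_row:
  assumes "baxter_slicing n P S" "1 \<le> i" "i \<le> card (top_row P)"
  shows "baxter_slicing (Suc n) (P \<union> new_row P i) (insert (new_row P i) S)"
proof -
  note P = baxter_slicing_polyomino[OF assms(1)]
  note Q = add_row_polyomino[OF P(1) assms(2,3)]
  have "P \<union> new_row P i - new_row P i = P" using Q(4) by blast
  then show ?thesis
    using baxter_slicing.horizontal[OF Q(1), of n S] Q(2,3) P(2) assms(1) by simp
qed

lemma baxter_slicing_add_column:
  assumes "baxter_slicing n P S" "1 \<le> j" "j \<le> card (right_column P)"
  shows "baxter_slicing (Suc n) (P \<union> new_column P j) (insert (new_column P j) S)"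
proof -
  note P = baxter_slicing_polyomino[OF assms(1)]
  note Q = add_column_polyomino[OF P(1) assms(2,3)]
  have "P \<union> new_column P j - new_column P j = P" using Q(4) by blast
  then show ?thesis
    using baxter_slicing.vertical[OF Q(1), of n S] Q(2,3) P(2) assms(1) by simp
qed

lemma slicing_child_cases:
  assumes "i < slicing_degree (P, S)"
  obtains "i < card (top_row P)" "slicing_child (P, S) i = add_row (P, S) (Suc i)"
  | j where "j < card (right_column P)" "i = card (top_row P) + j"
      "slicing_child (P, S) i = add_column (P, S) (Suc j)"
proof (cases "i < card (top_row P)")
  case True
  then show thesis using that(1) by (simp add: slicing_child_def)
next
  case False
  then show thesis using that(2)[of "i - card (top_row P)"] assms
    by (simp add: slicing_child_def slicing_degree_def)
qed

lemma slicing_child_in_baxter_slicings: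
  assumes "B \<in> baxter_slicings n" "i < slicing_degree B"
  shows "slicing_child B i \<in> baxter_slicings (Suc n)"
proof -
  obtain P S where B: "B = (P, S)" by (cases B)
  have PS: "baxter_slicing n P S" using assms(1) by (simp add: B baxter_slicings_def)
  from assms(2)[unfolded B] show ?thesis
    by (cases rule: slicing_child_cases)
       (auto simp: B baxter_slicings_def baxter_slicing_add_row[OF PS] baxter_slicing_add_column[OF PS])
qed

lemma length_child_labels_Bax:
  "length (child_labels Bax (slicing_label B)) = slicing_degree B"
  by (auto simp: Bax_def slicing_degree_def split: prod.splits)

lemma slicing_label_slicing_child:
  assumes "B \<in> baxter_slicings n" "i < slicing_degree B"
  shows "slicing_label (slicing_child B i) = child_labels Bax (slicing_label B) ! i"
proof -
  obtain P S where B: "B = (P, S)" by (cases B)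
  have "baxter_slicing n P S" using assms(1) by (simp add: B baxter_slicings_def)
  note P = baxter_slicing_polyomino(1)[OF this]
  from assms(2)[unfolded B] show ?thesis
  proof (cases rule: slicing_child_cases)
    case 1
    then show ?thesis using add_row_polyomino(5,6)[OF P, of "Suc i"]
      by (simp add: B Bax_def nth_append del: upt_Suc)
  next
    case (2 j)
    then show ?thesis using add_column_polyomino(5,6)[OF P, of "Suc j"]
      by (simp add: B Bax_def nth_append del: upt_Suc)
  qed
qed

section \<open>Recovering the parent of a slicing\<close>

lemma add_row_inverse:
  assumes "baxter_slicing n P S" "1 \<le> i" "i \<le> card (top_row P)" "add_row (P, S) i = (Q, T)"
  shows "P = Q - top_row Q" "S = T - {top_row Q}" "i = card (top_row Q)"
    "right_column Q \<notin> T"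
proof -
  note P = baxter_slicing_polyomino[OF assms(1)]
  note A = add_row_polyomino[OF P(1) assms(2,3)]
  have Q: "Q = P \<union> new_row P i" "T = insert (new_row P i) S" using assms(4) by auto
  have ne: "new_row P i \<noteq> {}" using A(8) by blast
  \<comment> \<open>Blocks of \<open>S\<close> lie in \<open>P\<close>, while the new row is
    nonempty and disjoint from \<open>P\<close>. Hence removing it from \<open>T\<close> leaves all
    of \<open>S\<close>.\<close>
  have "new_row P i \<notin> S" using ne A(4) P(4) by blast
  then show "P = Q - top_row Q" "S = T - {top_row Q}" "i = card (top_row Q)"
    using A(3,4,5) unfolding Q by auto
  have "right_column Q \<noteq> new_row P i" using A(4,7) unfolding Q by blast
  moreover have "right_column Q \<notin> S" using A(4,8) P(4) unfolding Q by blast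
  ultimately show "right_column Q \<notin> T" unfolding Q(2) by blast
qed

text \<open>The last conclusion is opposite to that of \<open>add_row_inverse\<close>, so the kind
  of the last block can be read off from \<open>(Q, T)\<close>.\<close>

lemma add_column_inverse:
  assumes "baxter_slicing n P S" "1 \<le> j" "j \<le> card (right_column P)" "add_column (P, S) j = (Q, T)"
  shows "P = Q - right_column Q" "S = T - {right_column Q}" "j = card (right_column Q)"
    "right_column Q \<in> T"
proof -
  note P = baxter_slicing_polyomino[OF assms(1)]
  note A = add_column_polyomino[OF P(1) assms(2,3)]
  have Q: "Q = P \<union> new_column P j" "T = insert (new_column P j) S" using assms(4) by auto
  have ne: "new_column P j \<noteq> {}" using A(3,5) assms(2) by auto
  have "new_column P j \<notin> S" using ne A(4) P(4) by blast
  then show "P = Q - right_column Q" "S = T - {right_column Q}" "j = card (right_column Q)"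
    "right_column Q \<in> T"
    using A(3,4,5) unfolding Q by auto
qed

text \<open>Whether the right column is a block decides between row and column; the inverse lemmas
  then return parent and index. The sizes \<open>n\<close> and \<open>n'\<close> are independent,
  since the parent in the tree is to be unique among slicings of all sizes.\<close>

lemma slicing_child_inject:
  assumes "B \<in> baxter_slicings n" "i < slicing_degree B"
    and "B' \<in> baxter_slicings n'" "i' < slicing_degree B'"
    and eq: "slicing_child B i = slicing_child B' i'"
  shows "B = B' \<and> i = i'"
proof -
  obtain P S P' S' where B: "B = (P, S)" "B' = (P', S')" by (cases B; cases B')
  have P: "baxter_slicing n P S" and P': "baxter_slicing n' P' S'"
    using assms(1,3) by (auto simp: B baxter_slicings_def)
  obtain Q T where Q: "slicing_child B i = (Q, T)" by (cases "slicing_child B i")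
  note Q' = Q[unfolded eq]
  show ?thesis
    using assms(2)[unfolded B]
  proof (cases rule: slicing_child_cases)
    case 1
    then have "add_row (P, S) (Suc i) = (Q, T)" using Q by (simp only: B)
    note r = add_row_inverse[OF P _ _ this]
    show ?thesis
      using assms(4)[unfolded B]
    proof (cases rule: slicing_child_cases)
      case row: 1
      then have "add_row (P', S') (Suc i') = (Q, T)" using Q' by (simp only: B)
      note r' = add_row_inverse[OF P' _ _ this]
      show ?thesis using r(1-3) r'(1-3) 1(1) row(1) by (simp add: B)
    next
      case (2 j)
      then have "add_column (P', S') (Suc j) = (Q, T)" using Q' by (simp only: B)
      note r' = add_column_inverse[OF P' _ _ this]
      show ?thesis using r(4) r'(4) 2(1) 1(1) by simp
    qed
  next
    case (2 j)
    then have "add_column (P, S) (Suc j) = (Q, T)" using Q by (simp only: B)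
    note c = add_column_inverse[OF P _ _ this]
    show ?thesis
      using assms(4)[unfolded B]
    proof (cases rule: slicing_child_cases)
      case 1
      then have "add_row (P', S') (Suc i') = (Q, T)" using Q' by (simp only: B)
      note r' = add_row_inverse[OF P' _ _ this]
      show ?thesis using c(4) r'(4) 1(1) 2(1) by simp
    next
      case col: (2 j')
      then have "add_column (P', S') (Suc j') = (Q, T)" using Q' by (simp only: B)
      note c' = add_column_inverse[OF P' _ _ this]
      have "P = P'" "S = S'" "j = j'"
        using c(1-3) c'(1-3) \<open>j < card (right_column P)\<close> \<open>j' < card (right_column P')\<close> by simp_all
      then show ?thesis
        using \<open>i = card (top_row P) + j\<close> \<open>i' = card (top_row P') + j'\<close> by (simp add: B)
    qed
  qed
qed

text \<open>The sizes recorded in the recursive definition of slicings supply the size hypothesis of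
  the deletion lemmas.\<close>

lemma baxter_slicings_SucE:
  assumes "C \<in> baxter_slicings (Suc n)" "n \<ge> 1"
  obtains B i where "B \<in> baxter_slicings n" "i < slicing_degree B" "C = slicing_child B i"
proof -
  obtain Q T where C: "C = (Q, T)" by (cases C)
  have Q: "baxter_slicing (Suc n) Q T" using assms(1) by (simp add: C baxter_slicings_def)
  from Q have "\<exists>B\<in>baxter_slicings n. \<exists>i<slicing_degree B. C = slicing_child B i"
  proof (cases rule: baxter_slicing.cases)
    case single
    then show ?thesis using assms(2) by simp
  next
    case (horizontal S)
    note P = baxter_slicing_polyomino[OF horizontal(4)]
    have "polyomino_size Q = Suc (polyomino_size (Q - top_row Q))" using horizontal P(2) by simp
    then obtain i where i: "1 \<le> i" "i \<le> card (top_row (Q - top_row Q))" "top_row Q = new_row (Q - top_row Q) i"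
      using delete_top_row[OF horizontal(2) P(1)] by blast
    have "Q - top_row Q \<union> top_row Q = Q" by (auto simp: top_row_def)
    then have "C = add_row (Q - top_row Q, S) i"
      unfolding C horizontal(1) add_row.simps i(3)[symmetric] by simp
    moreover have "(Q - top_row Q, S) \<in> baxter_slicings n"
      using horizontal(4) by (simp add: baxter_slicings_def)
    ultimately show ?thesis
      using i(1,2) unfolding ex_slicing_child_iff by (intro bexI[of _ "(Q - top_row Q, S)"]) auto
  next
    case (vertical S)
    note P = baxter_slicing_polyomino[OF vertical(4)]
    have "polyomino_size Q = Suc (polyomino_size (Q - right_column Q))" using vertical P(2) by simp
    then obtain j where j: "1 \<le> j" "j \<le> card (right_column (Q - right_column Q))"
        "right_column Q = new_column (Q - right_column Q) j"
      using delete_right_column[OF vertical(2) P(1)] by blast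
    have "Q - right_column Q \<union> right_column Q = Q" by (auto simp: right_column_def)
    then have "C = add_column (Q - right_column Q, S) j"
      unfolding C vertical(1) add_column.simps j(3)[symmetric] by simp
    moreover have "(Q - right_column Q, S) \<in> baxter_slicings n"
      using vertical(4) by (simp add: baxter_slicings_def)
    ultimately show ?thesis
      using j(1,2) unfolding ex_slicing_child_iff by (intro bexI[of _ "(Q - right_column Q, S)"]) auto
  qed
  then show thesis using that by blast
qed

section \<open>The rooted tree of slicings\<close>

lemma baxter_slicings_level_unique:
  "B \<in> baxter_slicings n \<Longrightarrow> B \<in> baxter_slicings m \<Longrightarrow> n = m"
  by (cases B) (auto simp: baxter_slicings_def dest: baxter_slicing_polyomino(2))

lemma mem_verts_baxter_tree_iff: "B \<in> verts baxter_tree \<longleftrightarrow> (\<exists>n. B \<in> baxter_slicings (Suc n))"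
proof
  assume "B \<in> verts baxter_tree"
  then obtain n where "n \<ge> 1" "B \<in> baxter_slicings n" by (auto simp: baxter_tree_def)
  then show "\<exists>n. B \<in> baxter_slicings (Suc n)" by (cases n) auto
qed (auto simp: baxter_tree_def)

lemma root_in_baxter_slicings_1: "root_vertex baxter_tree \<in> baxter_slicings 1"
  unfolding baxter_slicings_1 by (simp add: baxter_tree_def)

lemma mem_arcs_baxter_tree_iff:
  "(B, C) \<in> arcs baxter_tree \<longleftrightarrow>
     B \<in> verts baxter_tree \<and> (\<exists>i<slicing_degree B. C = slicing_child B i)"
proof
  assume "(B, C) \<in> arcs baxter_tree"
  then show "B \<in> verts baxter_tree \<and> (\<exists>i<slicing_degree B. C = slicing_child B i)"
    unfolding ex_slicing_child_iff by (auto simp: baxter_tree_def baxter_arc_def)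
next
  assume B: "B \<in> verts baxter_tree \<and> (\<exists>i<slicing_degree B. C = slicing_child B i)"
  then obtain n i where n: "B \<in> baxter_slicings (Suc n)" and i: "i < slicing_degree B" "C = slicing_child B i"
    unfolding mem_verts_baxter_tree_iff by blast
  have "C \<in> baxter_slicings (Suc n + 1)"
    using slicing_child_in_baxter_slicings[OF n i(1)] i(2) by simp
  with n have "\<exists>n\<ge>1. B \<in> baxter_slicings n \<and> C \<in> baxter_slicings (n + 1)"
    by (intro exI[of _ "Suc n"]) simp
  with B[THEN conjunct2, unfolded ex_slicing_child_iff] have "baxter_arc B C"
    unfolding baxter_arc_def by (rule conjI[rotated])
  then show "(B, C) \<in> arcs baxter_tree" by (simp add: baxter_tree_def)
qed

lemma children_baxter_tree:
  "B \<in> verts baxter_tree \<Longrightarrow> children baxter_tree B = slicing_child B ` {..<slicing_degree B}"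
  by (auto simp: children_def mem_arcs_baxter_tree_iff)

lemma rooted_tree_baxter_tree: "rooted_tree baxter_tree"
  unfolding rooted_tree_def
proof (intro conjI ballI allI)
  let ?r = "root_vertex baxter_tree"
  show "?r \<in> verts baxter_tree"
    using root_in_baxter_slicings_1 unfolding mem_verts_baxter_tree_iff by (metis One_nat_def)
  show "arcs baxter_tree \<subseteq> verts baxter_tree \<times> verts baxter_tree"
  proof
    fix a assume a: "a \<in> arcs baxter_tree"
    obtain B C where BC: "a = (B, C)" by (cases a)
    from a[unfolded BC] obtain n i where "B \<in> baxter_slicings (Suc n)" "i < slicing_degree B" "C = slicing_child B i"
      unfolding mem_arcs_baxter_tree_iff mem_verts_baxter_tree_iff by blast
    then show "a \<in> verts baxter_tree \<times> verts baxter_tree"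
      using slicing_child_in_baxter_slicings mem_verts_baxter_tree_iff unfolding BC by blast
  qed
  show "(u, ?r) \<notin> arcs baxter_tree" for u
  proof
    assume "(u, ?r) \<in> arcs baxter_tree"
    then obtain n i where "u \<in> baxter_slicings (Suc n)" "i < slicing_degree u" "?r = slicing_child u i"
      unfolding mem_arcs_baxter_tree_iff mem_verts_baxter_tree_iff by blast
    then have "?r \<in> baxter_slicings (Suc (Suc n))"
      using slicing_child_in_baxter_slicings by metis
    from baxter_slicings_level_unique[OF this root_in_baxter_slicings_1] show False by simp
  qed
  show "\<exists>!u. (u, v) \<in> arcs baxter_tree" if v: "v \<in> verts baxter_tree - {?r}" for v
  proof -
    obtain n where n: "v \<in> baxter_slicings (Suc n)"
      using DiffD1[OF v] unfolding mem_verts_baxter_tree_iff by blast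
    have "n \<noteq> 0"
    proof
      assume "n = 0"
      then have "v = ?r" using n baxter_slicings_1 root_in_baxter_slicings_1 by simp
      with v show False by simp
    qed
    then obtain B i where B: "B \<in> baxter_slicings n" "i < slicing_degree B" "v = slicing_child B i"
      using baxter_slicings_SucE[OF n] by auto
    show ?thesis
    proof (rule ex1I[of _ B])
      show "(B, v) \<in> arcs baxter_tree"
        unfolding mem_arcs_baxter_tree_iff mem_verts_baxter_tree_iff
        using B \<open>n \<noteq> 0\<close> by (metis not0_implies_Suc)
    next
      fix u assume "(u, v) \<in> arcs baxter_tree"
      then obtain m j where "u \<in> baxter_slicings (Suc m)" "j < slicing_degree u" "v = slicing_child u j"
        unfolding mem_arcs_baxter_tree_iff mem_verts_baxter_tree_iff by blast
      then show "u = B" using slicing_child_inject B by metis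
    qed
  qed
  show "(?r, v) \<in> (arcs baxter_tree)\<^sup>*" if v: "v \<in> verts baxter_tree" for v
  proof -
    obtain n where "v \<in> baxter_slicings (Suc n)" using v unfolding mem_verts_baxter_tree_iff by blast
    then show ?thesis
    proof (induction n arbitrary: v)
      case 0
      then have "v = ?r" using baxter_slicings_1 root_in_baxter_slicings_1 by simp
      then show ?case by simp
    next
      case (Suc n)
      then obtain B i where B: "B \<in> baxter_slicings (Suc n)" "i < slicing_degree B" "v = slicing_child B i"
        using baxter_slicings_SucE by (metis One_nat_def Suc_le_mono le0)
      then have "(B, v) \<in> arcs baxter_tree"
        unfolding mem_arcs_baxter_tree_iff mem_verts_baxter_tree_iff by blast
      with Suc.IH[OF B(1)] show ?case by (rule rtrancl.rtrancl_into_rtrancl)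
    qed
  qed
qed

section \<open>Isomorphism with the tree of the rule, through lists of child indices\<close>

primrec slicing_at :: "nat list \<Rightarrow> slicing" where
  "slicing_at [] = root_vertex baxter_tree"
| "slicing_at (i # w) = slicing_child (slicing_at w) i"

lemma slicing_label_root: "slicing_label (root_vertex baxter_tree) = (1, 1)"
proof -
  have "top_row {(0, 0)} = {(0, 0)}" "right_column {(0, 0)} = {(0, 0)}"
    by (auto simp: top_row_def right_column_def)
  then show ?thesis by (simp add: baxter_tree_def)
qed

lemma slicing_at_level:
  assumes "w \<in> rule_nodes Bax"
  shows "slicing_at w \<in> baxter_slicings (Suc (length w)) \<and> slicing_label (slicing_at w) = node_label Bax w"
  using assms
proof induction
  case 1
  then show ?case using root_in_baxter_slicings_1 slicing_label_root by (simp add: Bax_def)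
next
  case (2 w i)
  then have "i < slicing_degree (slicing_at w)"
    using length_child_labels_Bax[of "slicing_at w"] by simp
  with 2 show ?case
    using slicing_child_in_baxter_slicings[of "slicing_at w" "Suc (length w)" i]
      slicing_label_slicing_child[of "slicing_at w" "Suc (length w)" i] by simp
qed

text \<open>Labels agree along a list of choices, hence so do the numbers of children. Membership
  becomes a condition on the slicing to which the list leads.\<close>

lemma Cons_in_rule_nodes_iff:
  "i # w \<in> rule_nodes Bax \<longleftrightarrow> w \<in> rule_nodes Bax \<and> i < slicing_degree (slicing_at w)"
proof
  assume "i # w \<in> rule_nodes Bax"
  then show "w \<in> rule_nodes Bax \<and> i < slicing_degree (slicing_at w)"
    by (cases rule: rule_nodes.cases) (metis length_child_labels_Bax slicing_at_level)
next
  assume "w \<in> rule_nodes Bax \<and> i < slicing_degree (slicing_at w)"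
  then show "i # w \<in> rule_nodes Bax"
    by (metis length_child_labels_Bax slicing_at_level rule_nodes.intros(2))
qed

text \<open>The size of the slicing fixes the length of the list, and
  \<open>slicing_child_inject\<close> peels off the latest choice.\<close>

lemma inj_on_slicing_at: "inj_on slicing_at (rule_nodes Bax)"
proof (rule inj_onI)
  fix v w assume "v \<in> rule_nodes Bax" "w \<in> rule_nodes Bax" "slicing_at v = slicing_at w"
  then show "v = w"
  proof (induction v arbitrary: w rule: list.induct)
    case Nil
    then have "length w = 0"
      using slicing_at_level[of w] slicing_at_level[of "[]"] baxter_slicings_level_unique by (metis Suc_inject list.size(3))
    then show ?case by simp
  next
    case (Cons i v)
    then have "length w = Suc (length v)"
      using slicing_at_level[of w] slicing_at_level[of "i # v"] baxter_slicings_level_unique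
      by (metis Suc_inject length_Cons)
    then obtain j u where w: "w = j # u" by (cases w) auto
    have v: "v \<in> rule_nodes Bax" "i < slicing_degree (slicing_at v)"
      and u: "u \<in> rule_nodes Bax" "j < slicing_degree (slicing_at u)"
      using Cons.prems Cons_in_rule_nodes_iff w by blast+
    have "slicing_at v = slicing_at u \<and> i = j"
      using slicing_child_inject[of "slicing_at v" _ i "slicing_at u" _ j] slicing_at_level u v Cons.prems(3) w
      by (metis slicing_at.simps(2))
    then show ?case using Cons.IH[OF v(1) u(1)] w by simp
  qed
qed

lemma bij_betw_slicing_at: "bij_betw slicing_at (rule_nodes Bax) (verts baxter_tree)"
  unfolding bij_betw_def
proof
  show "slicing_at ` rule_nodes Bax = verts baxter_tree"
  proof
    show "slicing_at ` rule_nodes Bax \<subseteq> verts baxter_tree"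
      using slicing_at_level mem_verts_baxter_tree_iff by blast
    have "B \<in> slicing_at ` rule_nodes Bax" if "B \<in> baxter_slicings (Suc n)" for B n
      using that
    proof (induction n arbitrary: B)
      case 0
      then have "B = slicing_at []" using baxter_slicings_1 root_in_baxter_slicings_1 by simp
      then show ?case using rule_nodes.intros(1) by blast
    next
      case (Suc n)
      then obtain C i where C: "C \<in> baxter_slicings (Suc n)" "i < slicing_degree C" "B = slicing_child C i"
        using baxter_slicings_SucE by (metis One_nat_def Suc_le_mono le0)
      from Suc.IH[OF C(1)] obtain w where w: "w \<in> rule_nodes Bax" "C = slicing_at w" by blast
      then have "i # w \<in> rule_nodes Bax" using C(2) Cons_in_rule_nodes_iff by blast
      moreover have "B = slicing_at (i # w)" using C(3) w(2) by simp
      ultimately show ?case by blast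
    qed
    then show "verts baxter_tree \<subseteq> slicing_at ` rule_nodes Bax"
      using mem_verts_baxter_tree_iff by blast
  qed
qed (rule inj_on_slicing_at)

lemma isomorphic_baxter_tree: "isomorphic_trees baxter_tree (rule_tree Bax)"
  unfolding isomorphic_trees_def
proof (intro exI[of _ "inv_into (rule_nodes Bax) slicing_at"] conjI ballI)
  let ?\<phi> = "inv_into (rule_nodes Bax) slicing_at"
  have inv: "?\<phi> (slicing_at w) = w" if "w \<in> rule_nodes Bax" for w
    using that inj_on_slicing_at by (rule inv_into_f_f[rotated])
  have ex: "\<exists>w\<in>rule_nodes Bax. B = slicing_at w" if "B \<in> verts baxter_tree" for B
    using that bij_betw_slicing_at by (auto simp: bij_betw_def)
  show "bij_betw ?\<phi> (verts baxter_tree) (verts (rule_tree Bax))"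
    using bij_betw_inv_into[OF bij_betw_slicing_at] by (simp add: rule_tree_def)
  show "?\<phi> (root_vertex baxter_tree) = root_vertex (rule_tree Bax)"
    using inv[OF rule_nodes.intros(1)] by (simp add: rule_tree_def)
  show "lab (rule_tree Bax) (?\<phi> v) = lab baxter_tree v" if "v \<in> verts baxter_tree" for v
    using ex[OF that] inv slicing_at_level by (auto simp: rule_tree_def baxter_tree_def)
  show "(u, v) \<in> arcs baxter_tree \<longleftrightarrow> (?\<phi> u, ?\<phi> v) \<in> arcs (rule_tree Bax)"
    if uv: "u \<in> verts baxter_tree" "v \<in> verts baxter_tree" for u v
  proof -
    obtain a b where a: "a \<in> rule_nodes Bax" "u = slicing_at a" and b: "b \<in> rule_nodes Bax" "v = slicing_at b"
      using ex[OF uv(1)] ex[OF uv(2)] by blast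
    have "(?\<phi> u, ?\<phi> v) \<in> arcs (rule_tree Bax) \<longleftrightarrow> (\<exists>i. b = i # a)"
      using a b inv by (auto simp: rule_tree_def)
    also have "\<dots> \<longleftrightarrow> (\<exists>i<slicing_degree u. v = slicing_child u i)"
    proof
      assume "\<exists>i. b = i # a"
      then show "\<exists>i<slicing_degree u. v = slicing_child u i"
        using a b Cons_in_rule_nodes_iff by auto
    next
      assume "\<exists>i<slicing_degree u. v = slicing_child u i"
      then obtain i where i: "i < slicing_degree u" "v = slicing_child u i" by blast
      then have "i # a \<in> rule_nodes Bax" "slicing_at (i # a) = slicing_at b"
        using a b Cons_in_rule_nodes_iff by auto
      then show "\<exists>i. b = i # a" using inj_on_slicing_at b(1) by (metis inj_onD)
    qed
    also have "\<dots> \<longleftrightarrow> (u, v) \<in> arcs baxter_tree"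
      using uv mem_arcs_baxter_tree_iff by simp
    finally show ?thesis ..
  qed
qed

section \<open>Labels and numbers of the slicings of a given size\<close>

lemma sum_child_labels_Bax:
  fixes f :: "nat \<times> nat \<Rightarrow> real"
  shows "(\<Sum>i<length (child_labels Bax (h, k)). f (child_labels Bax (h, k) ! i)) =
    (\<Sum>i=1..h. f (i, k + 1)) + (\<Sum>j=1..k. f (h + 1, j))"
proof -
  have "(\<Sum>i<length (child_labels Bax (h, k)). f (child_labels Bax (h, k) ! i)) =
      sum_list (map f (child_labels Bax (h, k)))"
    by (simp add: sum_list_sum_nth atLeast0LessThan)
  also have "\<dots> = (\<Sum>i=1..h. f (i, k + 1)) + (\<Sum>j=1..k. f (h + 1, j))"
    by (simp add: Bax_def comp_def interv_sum_list_conv_sum_set_nat atLeastLessThanSuc_atLeastAtMost del: upt_Suc)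
  finally show ?thesis .
qed

text \<open>The slicings of the next size correspond to the pairs of a slicing and a child index.
  \<open>f\<close> stays arbitrary in the induction because the step applies the hypothesis to the
  sum of \<open>f\<close> over the children.\<close>

lemma sum_baxter_slicings:
  fixes f :: "nat \<times> nat \<Rightarrow> real"
  shows "finite (baxter_slicings (Suc m)) \<and>
    (\<Sum>B\<in>baxter_slicings (Suc m). f (slicing_label B)) = bax_level_sum m f"
proof (induction m arbitrary: f)
  case 0
  have "baxter_slicings (Suc 0) = {root_vertex baxter_tree}"
    using baxter_slicings_1 root_in_baxter_slicings_1 by simp
  then show ?case
    using slicing_label_root by (simp add: bax_level_sum_def bax_count_def)
next
  case (Suc m)
  let ?D = "Sigma (baxter_slicings (Suc m)) (\<lambda>B. {..<slicing_degree B})"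
  let ?c = "\<lambda>(B, i). slicing_child B i"
  have fin: "finite (baxter_slicings (Suc m))" using Suc.IH by blast
  have level: "baxter_slicings (Suc (Suc m)) = ?c ` ?D"
  proof
    show "?c ` ?D \<subseteq> baxter_slicings (Suc (Suc m))"
      using slicing_child_in_baxter_slicings by auto
    show "baxter_slicings (Suc (Suc m)) \<subseteq> ?c ` ?D"
    proof
      fix C assume "C \<in> baxter_slicings (Suc (Suc m))"
      then obtain B i where "B \<in> baxter_slicings (Suc m)" "i < slicing_degree B" "C = slicing_child B i"
        by (rule baxter_slicings_SucE) auto
      then show "C \<in> ?c ` ?D" by force
    qed
  qed
  have inj: "inj_on ?c ?D"
  proof (rule inj_onI)
    fix x y assume "x \<in> ?D" "y \<in> ?D" "?c x = ?c y"
    then show "x = y"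
      using slicing_child_inject[of "fst x" "Suc m" "snd x" "fst y" "Suc m" "snd y"]
      by (auto simp: case_prod_unfold prod_eq_iff)
  qed
  have "(\<Sum>C\<in>baxter_slicings (Suc (Suc m)). f (slicing_label C)) =
      (\<Sum>(B, i)\<in>?D. f (slicing_label (slicing_child B i)))"
    unfolding level by (subst sum.reindex[OF inj]) (simp add: case_prod_unfold)
  also have "\<dots> = (\<Sum>B\<in>baxter_slicings (Suc m). \<Sum>i<slicing_degree B. f (slicing_label (slicing_child B i)))"
    using fin by (subst sum.Sigma) auto
  also have "\<dots> = (\<Sum>B\<in>baxter_slicings (Suc m). case slicing_label B of (h, k) \<Rightarrow>
      (\<Sum>i=1..h. f (i, k + 1)) + (\<Sum>j=1..k. f (h + 1, j)))"
  proof (rule sum.cong[OF refl])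
    fix B assume B: "B \<in> baxter_slicings (Suc m)"
    obtain h k where hk: "slicing_label B = (h, k)" by (cases "slicing_label B")
    have "(\<Sum>i<slicing_degree B. f (slicing_label (slicing_child B i))) =
        (\<Sum>i<slicing_degree B. f (child_labels Bax (slicing_label B) ! i))"
      using slicing_label_slicing_child[OF B] by (intro sum.cong) auto
    then show "(\<Sum>i<slicing_degree B. f (slicing_label (slicing_child B i))) =
        (case slicing_label B of (h, k) \<Rightarrow> (\<Sum>i=1..h. f (i, k + 1)) + (\<Sum>j=1..k. f (h + 1, j)))"
      unfolding length_child_labels_Bax[symmetric] hk sum_child_labels_Bax by simp
  qed
  also have "\<dots> = bax_level_sum m (\<lambda>(h, k). (\<Sum>i=1..h. f (i, k + 1)) + (\<Sum>j=1..k. f (h + 1, j)))"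
    using Suc.IH by blast
  also have "\<dots> = bax_level_sum (Suc m) f"
    by (rule bax_level_sum_Suc)
  finally show ?case unfolding level using fin by auto
qed

text \<open>Distinct indices give distinct children, so the labels agree with the list of the rule
  index by index, multiplicities included.\<close>

lemma image_mset_lab_children:
  assumes "B \<in> verts baxter_tree"
  shows "image_mset (lab baxter_tree) (mset_set (children baxter_tree B)) =
    mset (child_labels Bax (slicing_label B))"
proof -
  obtain n where n: "B \<in> baxter_slicings (Suc n)" using assms mem_verts_baxter_tree_iff by blast
  have inj: "inj_on (slicing_child B) {..<slicing_degree B}"
    using slicing_child_inject n by (intro inj_onI) (metis lessThan_iff)
  have "image_mset (lab baxter_tree) (mset_set (children baxter_tree B)) =
      image_mset (\<lambda>i. slicing_label (slicing_child B i)) (mset_set {..<slicing_degree B})"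
    unfolding children_baxter_tree[OF assms] image_mset_mset_set[OF inj, symmetric]
    by (simp add: baxter_tree_def multiset.map_comp comp_def)
  also have "\<dots> = image_mset (\<lambda>i. child_labels Bax (slicing_label B) ! i) (mset_set {..<slicing_degree B})"
    using slicing_label_slicing_child[OF n] by (intro image_mset_cong) auto
  also have "\<dots> = mset (map (\<lambda>i. child_labels Bax (slicing_label B) ! i) [0..<slicing_degree B])"
    by (simp add: atLeast0LessThan[symmetric] del: upt_Suc)
  also have "\<dots> = mset (child_labels Bax (slicing_label B))"
    unfolding length_child_labels_Bax[symmetric] map_nth ..
  finally show ?thesis .
qed

theorem theorem1:
  shows "baxter_slicings 1 = {root_vertex baxter_tree} \<and>
    rooted_tree baxter_tree \<and>
    lab baxter_tree (root_vertex baxter_tree) = (1, 1) \<and>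
    (\<forall>B h k. B \<in> verts baxter_tree \<and> lab baxter_tree B = (h, k) \<longrightarrow>
       finite (children baxter_tree B) \<and>
       image_mset (lab baxter_tree) (mset_set (children baxter_tree B)) =
         mset (map (\<lambda>i. (i, k + 1)) [1..<h + 1] @ map (\<lambda>j. (h + 1, j)) [1..<k + 1])) \<and>
    grows_according_to baxter_tree Bax \<and>
    (\<forall>n\<ge>1. finite (baxter_slicings n) \<and> real (card (baxter_slicings n)) = baxter_number n)"
proof (intro conjI allI impI)
  show "baxter_slicings 1 = {root_vertex baxter_tree}"
    using baxter_slicings_1 root_in_baxter_slicings_1 by simp
  show "lab baxter_tree (root_vertex baxter_tree) = (1, 1)"
    using slicing_label_root by (simp add: baxter_tree_def)
  show "grows_according_to baxter_tree Bax"
    unfolding grows_according_to_def using rooted_tree_baxter_tree isomorphic_baxter_tree by blast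
  fix B h k assume B: "B \<in> verts baxter_tree \<and> lab baxter_tree B = (h, k)"
  then show "finite (children baxter_tree B)" by (simp add: children_baxter_tree)
  have "slicing_label B = (h, k)" using B by (simp add: baxter_tree_def)
  then show "image_mset (lab baxter_tree) (mset_set (children baxter_tree B)) =
      mset (map (\<lambda>i. (i, k + 1)) [1..<h + 1] @ map (\<lambda>j. (h + 1, j)) [1..<k + 1])"
    using image_mset_lab_children[of B] B by (simp add: Bax_def del: upt_Suc)
next
  fix n :: nat assume "1 \<le> n"
  then obtain m where m: "n = Suc m" by (cases n) auto
  show "finite (baxter_slicings n)" using sum_baxter_slicings m by blast
  \<comment> \<open>The constant function 1 turns the level sum into the number of slicings.\<close>
  have "real (card (baxter_slicings n)) = bax_level_sum m (\<lambda>_. 1)"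
    using sum_baxter_slicings[of m "\<lambda>_. 1"] by (simp add: m)
  then show "real (card (baxter_slicings n)) = baxter_number n"
    unfolding m baxter_number_eq_sum_bax_count bax_level_sum_def by simp
qed (rule rooted_tree_baxter_tree)

end
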